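(* The variety $\mathsf{V}(SR_6)$ generated by the six-element ai-semiring $SR_6$ is a limit variety; that is, $\mathsf{V}(SR_6)$ is nonfinitely based, and every proper subvariety of $\mathsf{V}(SR_6)$ is finitely based.
   Context: An additively idempotent semiring (ai-semiring) is an algebra $(S,+,\cdot)$ (two binary operations, no constants) such that $(S,+)$ is a commutative idempotent semigroup, $(S,\cdot)$ is a semigroup, and $x(y+z)\approx xy+xz$, $(x+y)z\approx xz+yz$ hold. $SR_6$ is the ai-semiring with underlying set $\{1,2,3,4,5,6\}$ and the following commutative operations. Addition: $i+i=i$ for all $i$; $2+5=5+2=2$; $4+6=6+4=4$; all other sums of two distinct elements equal $1$. Multiplication: $2\cdot 6=6\cdot 2=3$, $4\cdot 5=5\cdot 4=3$, $5\cdot 6=6\cdot 5=3$; all other products equal $1$. A variety is a class of algebras closed under subalgebras, homomorphic images and arbitrary direct products. $\mathsf{V}(A)$ denotes the variety generated by $A$. A variety is finitely based if it can be defined by a finite set of identities, and nonfinitely based otherwise. *)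

theory Defs
  imports Main "HOL-Library.FuncSet" "HOL-Library.Infinite_Typeclass"
begin

section \<open>Algebras with two binary operations\<close>

record 'a algebra =
  carr :: "'a set"
  add_op :: "'a \<Rightarrow> 'a \<Rightarrow> 'a"
  mul_op :: "'a \<Rightarrow> 'a \<Rightarrow> 'a"

definition is_algebra :: "'a algebra \<Rightarrow> bool" where
  "is_algebra A \<longleftrightarrow> carr A \<noteq> {} \<and>
     (\<forall>x\<in>carr A. \<forall>y\<in>carr A. add_op A x y \<in> carr A \<and> mul_op A x y \<in> carr A)"

definition is_ai_semiring :: "'a algebra \<Rightarrow> bool" where
  "is_ai_semiring A \<longleftrightarrow> is_algebra A \<and>
     (\<forall>x\<in>carr A. add_op A x x = x) \<and>
     (\<forall>x\<in>carr A. \<forall>y\<in>carr A. add_op A x y = add_op A y x) \<and>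
     (\<forall>x\<in>carr A. \<forall>y\<in>carr A. \<forall>z\<in>carr A.
        add_op A (add_op A x y) z = add_op A x (add_op A y z) \<and>
        mul_op A (mul_op A x y) z = mul_op A x (mul_op A y z) \<and>
        mul_op A x (add_op A y z) = add_op A (mul_op A x y) (mul_op A x z) \<and>
        mul_op A (add_op A x y) z = add_op A (mul_op A x z) (mul_op A y z))"

definition subalgebra :: "'a algebra \<Rightarrow> 'a algebra \<Rightarrow> bool" where
  "subalgebra B A \<longleftrightarrow> is_algebra B \<and> carr B \<subseteq> carr A \<and>
     (\<forall>x\<in>carr B. \<forall>y\<in>carr B. add_op B x y = add_op A x y \<and> mul_op B x y = mul_op A x y)"

definition alg_hom :: "'a algebra \<Rightarrow> 'b algebra \<Rightarrow> ('a \<Rightarrow> 'b) \<Rightarrow> bool" where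
  "alg_hom A B f \<longleftrightarrow> is_algebra A \<and> is_algebra B \<and> f \<in> carr A \<rightarrow> carr B \<and>
     (\<forall>x\<in>carr A. \<forall>y\<in>carr A. f (add_op A x y) = add_op B (f x) (f y) \<and>
                              f (mul_op A x y) = mul_op B (f x) (f y))"

definition homomorphic_image :: "'b algebra \<Rightarrow> 'a algebra \<Rightarrow> bool" where
  "homomorphic_image B A \<longleftrightarrow> (\<exists>f. alg_hom A B f \<and> f ` carr A = carr B)"

definition isomorphic :: "'a algebra \<Rightarrow> 'b algebra \<Rightarrow> bool" where
  "isomorphic A B \<longleftrightarrow> (\<exists>f. alg_hom A B f \<and> bij_betw f (carr A) (carr B))"

definition direct_product :: "'i set \<Rightarrow> ('i \<Rightarrow> 'a algebra) \<Rightarrow> ('i \<Rightarrow> 'a) algebra" where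
  "direct_product I A =
     \<lparr>carr = (\<Pi>\<^sub>E i\<in>I. carr (A i)),
      add_op = (\<lambda>x y. \<lambda>i\<in>I. add_op (A i) (x i) (y i)),
      mul_op = (\<lambda>x y. \<lambda>i\<in>I. mul_op (A i) (x i) (y i))\<rparr>"


section \<open>Varieties\<close>

text \<open>
  A class of algebras is a set of algebras whose carriers are subsets of a type
  \<open>'u\<close>, to be read for an arbitrary infinite \<open>'u\<close> (so for algebras of any prescribed
  cardinality). A direct product need not fit into \<open>'u\<close>, even when some of its
  subalgebras do. Hence closure under direct products is stated for every algebra over \<open>'u\<close>
  that is isomorphic to a subalgebra of a product, the product itself included: asking
  only for the products that fit into \<open>'u\<close> would admit, for instance over a countable \<open>'u\<close>,
  the class of all finite algebras. With this reading a set of algebras over \<open>'u\<close> is a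
  variety iff it is the restriction to \<open>'u\<close> of a variety in the usual sense, and the latter
  is determined by its countable members.

  Index sets of type \<open>'u set\<close> are no restriction: to embed an algebra over the infinite type
  \<open>'u\<close> into a product, one index for each pair of distinct elements is enough.
  The index set may be empty, so that a variety contains the one-element algebras.
\<close>

definition variety :: "'u algebra set \<Rightarrow> bool" where
  "variety K \<longleftrightarrow>
     (\<forall>A\<in>K. is_algebra A) \<and>
     (\<forall>A\<in>K. \<forall>B. subalgebra B A \<longrightarrow> B \<in> K) \<and>
     (\<forall>A\<in>K. \<forall>B. homomorphic_image B A \<longrightarrow> B \<in> K) \<and>
     (\<forall>(I :: 'u set) A B C. (\<forall>i\<in>I. A i \<in> K) \<and> subalgebra C (direct_product I A) \<and> isomorphic C B
        \<longrightarrow> B \<in> K)"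

text \<open>
  The generator may live on a type different from \<open>'u\<close>. If it has no isomorphic copy over
  \<open>'u\<close>, the result is not meaningful; a finite generator always has one.
\<close>

definition variety_generated_by :: "'a algebra \<Rightarrow> 'u algebra set" where
  "variety_generated_by A = \<Inter>{K. variety K \<and> (\<forall>B. isomorphic A B \<longrightarrow> B \<in> K)}"


section \<open>Identities and finite bases\<close>

datatype trm = Var nat | Plus trm trm | Times trm trm

primrec eval_trm :: "'a algebra \<Rightarrow> (nat \<Rightarrow> 'a) \<Rightarrow> trm \<Rightarrow> 'a" where
  "eval_trm A h (Var n) = h n"
| "eval_trm A h (Plus s t) = add_op A (eval_trm A h s) (eval_trm A h t)"
| "eval_trm A h (Times s t) = mul_op A (eval_trm A h s) (eval_trm A h t)"

definition satisfies :: "'a algebra \<Rightarrow> trm \<times> trm \<Rightarrow> bool" where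
  "satisfies A e \<longleftrightarrow> (\<forall>h. range h \<subseteq> carr A \<longrightarrow> eval_trm A h (fst e) = eval_trm A h (snd e))"

definition models :: "(trm \<times> trm) set \<Rightarrow> 'u algebra set" where
  "models \<Sigma> = {A. is_algebra A \<and> (\<forall>e\<in>\<Sigma>. satisfies A e)}"

definition finitely_based :: "'u algebra set \<Rightarrow> bool" where
  "finitely_based K \<longleftrightarrow> (\<exists>\<Sigma>. finite \<Sigma> \<and> K = models \<Sigma>)"

definition limit_variety :: "'u algebra set \<Rightarrow> bool" where
  "limit_variety V \<longleftrightarrow> variety V \<and> \<not> finitely_based V \<and>
     (\<forall>W. variety W \<and> W \<subset> V \<longrightarrow> finitely_based W)"


section \<open>The semiring $SR_6$\<close>

definition sr6_add :: "nat \<Rightarrow> nat \<Rightarrow> nat" where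
  "sr6_add i j =
     (if i = j then i
      else if (i, j) \<in> {(2, 5), (5, 2)} then 2
      else if (i, j) \<in> {(4, 6), (6, 4)} then 4
      else 1)"

definition sr6_mul :: "nat \<Rightarrow> nat \<Rightarrow> nat" where
  "sr6_mul i j = (if (i, j) \<in> {(2, 6), (6, 2), (4, 5), (5, 4), (5, 6), (6, 5)} then 3 else 1)"

definition SR6 :: "nat algebra" where
  "SR6 = \<lparr>carr = {1, 2, 3, 4, 5, 6}, add_op = sr6_add, mul_op = sr6_mul\<rparr>"

lemma is_ai_semiring_SR6: "is_ai_semiring SR6"
  by (simp add: is_ai_semiring_def is_algebra_def SR6_def sr6_add_def sr6_mul_def)

lemma variety_variety_generated_by:
  "variety (variety_generated_by A :: 'u algebra set)"
proof -
  have U: "variety {B :: 'u algebra. is_algebra B}"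
    by (auto simp: variety_def subalgebra_def homomorphic_image_def isomorphic_def alg_hom_def)
  have alg: "is_algebra B" if "B \<in> variety_generated_by A" for B :: "'u algebra"
    using that U unfolding variety_generated_by_def
    by (force simp: isomorphic_def alg_hom_def)
  show ?thesis
    unfolding variety_def
  proof (intro conjI ballI allI impI)
    fix B :: "'u algebra" assume "B \<in> variety_generated_by A"
    then show "is_algebra B" by (rule alg)
  next
    fix B C :: "'u algebra" assume "B \<in> variety_generated_by A" "subalgebra C B"
    then show "C \<in> variety_generated_by A"
      unfolding variety_generated_by_def variety_def by blast
  next
    fix B C :: "'u algebra" assume "B \<in> variety_generated_by A" "homomorphic_image C B"
    then show "C \<in> variety_generated_by A"
      unfolding variety_generated_by_def variety_def by blast
  next
    fix I :: "'u set" and F :: "'u \<Rightarrow> 'u algebra" and B :: "'u algebra" and C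
    assume *: "(\<forall>i\<in>I. F i \<in> variety_generated_by A) \<and>
      subalgebra C (direct_product I F) \<and> isomorphic C B"
    show "B \<in> variety_generated_by A"
      unfolding variety_generated_by_def
    proof (rule InterI)
      fix K :: "'u algebra set" assume K: "K \<in> {K. variety K \<and> (\<forall>B. isomorphic A B \<longrightarrow> B \<in> K)}"
      then have "\<forall>i\<in>I. F i \<in> K"
        using * by (auto simp: variety_generated_by_def)
      moreover have "variety K" using K by simp
      ultimately show "B \<in> K"
        using * unfolding variety_def by blast
    qed
  qed
qed

end

theory Submission
  imports Defs
begin

text \<open>
  Write \<open>0\<close> for the element \<open>1\<close> of SR6, which absorbs under both operations. Words of length
  three, squares and sums \<open>x + xy\<close> are zero in SR6, so a term is either zero or a sum of
  variables and of products \<open>xy\<close> of distinct variables, in which no variable occurs in both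
  ways. The products are the edges of a graph on the variables. If this graph is not
  bipartite, the term is zero: an edge with a nonzero value joins the classes \<open>{2, 5}\<close> and
  \<open>{4, 6}\<close>. If it is bipartite, the variables and the edges are determined by the values of
  the term (\<open>satisfies_SR6\<close>).

  Nonfinite basis. The sum of the products along any odd cycle is zero in SR6, and these
  identities do not follow from those in a bounded number of variables. The witness is the
  semiring of vertex sets of a long odd cycle: a set of vertices smaller than the cycle spans
  a bipartite graph, so all short identities hold, while the cycle itself is not zero
  (\<open>not_finitely_based_V\<close>).

  Proper subvarieties. Let an identity \<open>s = t\<close> fail in SR6. If the two sides differ in a
  variable summand, or if only one is zero, or if \<open>s\<close> has an edge whose ends are not on
  opposite sides of one component of \<open>t\<close>, then collapsing the bipartite graph of \<open>t\<close> to a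
  single edge yields \<open>ab = 0\<close>. Otherwise \<open>s\<close> has, up to exchanging the two sides, an edge
  joining two nonadjacent vertices on opposite sides of a component of \<open>t\<close>, and folding that
  component to a path of length three yields the path law \<open>ab + bc + cd = ab + bc + cd + ad\<close>;
  this law also follows from \<open>ab = 0\<close>. So every proper subvariety satisfies the path law. The
  path law makes all odd cycles zero, which is why finitely many identities now suffice, and
  it leaves a term with no more information than its variables and the two sides of each
  component. By the same collapse, any identity that does not respect these data gives
  \<open>ab = 0\<close>, and an identity beyond \<open>ab = 0\<close> trivialises the algebra. Thus the proper
  subvarieties form a chain of three: the path law, \<open>ab = 0\<close>, and \<open>x = y\<close>, each relative to
  finitely many laws (\<open>proper_subvariety_finitely_based\<close>).

  That the members of a subvariety are exactly the algebras satisfying its identities is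
  Birkhoff's theorem (\<open>variety_closed_under_identities\<close>).
\<close>


section \<open>Identities and the class operators\<close>

lemma eval_closed:
  assumes "is_algebra A" "range h \<subseteq> carr A"
  shows "eval_trm A h t \<in> carr A"
  using assms by (induction t) (auto simp: is_algebra_def)

lemma hom_eval:
  assumes "alg_hom A B f" "range h \<subseteq> carr A"
  shows "eval_trm B (f \<circ> h) t = f (eval_trm A h t)"
proof (induction t)
  case (Plus s t)
  then show ?case
    using assms eval_closed[of A h] by (simp add: alg_hom_def)
next
  case (Times s t)
  then show ?case
    using assms eval_closed[of A h] by (simp add: alg_hom_def)
qed simp

lemma satisfies_subalgebra:
  assumes "subalgebra B A" "satisfies A e"
  shows "satisfies B e"
proof -
  have "eval_trm B h t = eval_trm A h t" if "range h \<subseteq> carr B" for h t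
  proof (induction t)
    case (Plus s t)
    then show ?case
      using assms(1) that eval_closed[of B h s] eval_closed[of B h t] by (simp add: subalgebra_def)
  next
    case (Times s t)
    then show ?case
      using assms(1) that eval_closed[of B h s] eval_closed[of B h t] by (simp add: subalgebra_def)
  qed simp
  moreover have "range h \<subseteq> carr A" if "range h \<subseteq> carr B" for h :: "nat \<Rightarrow> 'a"
    using assms(1) that by (auto simp: subalgebra_def)
  ultimately show ?thesis
    using assms(2) by (simp add: satisfies_def)
qed

lemma satisfies_homomorphic_image:
  assumes "homomorphic_image B A" "satisfies A e"
  shows "satisfies B e"
  unfolding satisfies_def
proof (intro allI impI)
  fix h :: "nat \<Rightarrow> _" assume h: "range h \<subseteq> carr B"
  obtain f where f: "alg_hom A B f" "f ` carr A = carr B"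
    using assms(1) unfolding homomorphic_image_def by blast
  define k where "k = inv_into (carr A) f \<circ> h"
  have "h n \<in> f ` carr A" for n using h f(2) by auto
  then have "h = f \<circ> k" "range k \<subseteq> carr A"
    by (auto simp: k_def f_inv_into_f inv_into_into)
  then show "eval_trm B h (fst e) = eval_trm B h (snd e)"
    using hom_eval[OF f(1)] assms(2) by (simp add: satisfies_def)
qed

lemma satisfies_direct_product:
  assumes "\<And>i. i \<in> I \<Longrightarrow> satisfies (F i) e"
  shows "satisfies (direct_product I F) e"
  unfolding satisfies_def
proof (intro allI impI)
  fix h :: "nat \<Rightarrow> _" assume h: "range h \<subseteq> carr (direct_product I F)"
  have ext: "h n \<in> (\<Pi>\<^sub>E i\<in>I. carr (F i))" for n
    using h by (auto simp: direct_product_def)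
  have ev: "eval_trm (direct_product I F) h t = (\<lambda>i\<in>I. eval_trm (F i) (\<lambda>n. h n i) t)" for t
  proof (induction t)
    case (Var n)
    show ?case using ext[of n] by (auto simp: restrict_def PiE_def extensional_def)
  qed (auto simp: direct_product_def fun_eq_iff)
  have "eval_trm (F i) (\<lambda>n. h n i) (fst e) = eval_trm (F i) (\<lambda>n. h n i) (snd e)" if "i \<in> I" for i
  proof -
    have "range (\<lambda>n. h n i) \<subseteq> carr (F i)" using PiE_mem[OF ext that] by auto
    then show ?thesis using assms[OF that] by (simp add: satisfies_def)
  qed
  then show "eval_trm (direct_product I F) h (fst e) = eval_trm (direct_product I F) h (snd e)"
    by (simp add: ev cong: restrict_cong)
qed

lemma isomorphic_imp_homomorphic_image: "isomorphic A B \<Longrightarrow> homomorphic_image B A"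
  by (auto simp: isomorphic_def homomorphic_image_def bij_betw_def)

lemma isomorphic_sym:
  assumes "isomorphic A B"
  shows "isomorphic B A"
proof -
  obtain f where f: "alg_hom A B f" "bij_betw f (carr A) (carr B)"
    using assms unfolding isomorphic_def by blast
  let ?g = "inv_into (carr A) f"
  have g: "?g y \<in> carr A" "f (?g y) = y" if "y \<in> carr B" for y
    using bij_betwE[OF bij_betw_inv_into[OF f(2)]] bij_betw_inv_into_right[OF f(2)] that by blast+
  have gf: "?g (f x) = x" if "x \<in> carr A" for x
    using bij_betw_inv_into_left[OF f(2) that] .
  have "?g (add_op B x y) = add_op A (?g x) (?g y)" "?g (mul_op B x y) = mul_op A (?g x) (?g y)"
    if "x \<in> carr B" "y \<in> carr B" for x y
  proof -
    have "add_op B x y = f (add_op A (?g x) (?g y))" "mul_op B x y = f (mul_op A (?g x) (?g y))"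
      using f(1) g[OF that(1)] g[OF that(2)] unfolding alg_hom_def by simp_all
    moreover have "add_op A (?g x) (?g y) \<in> carr A" "mul_op A (?g x) (?g y) \<in> carr A"
      using f(1) g[OF that(1)] g[OF that(2)] unfolding alg_hom_def is_algebra_def by blast+
    ultimately show "?g (add_op B x y) = add_op A (?g x) (?g y)" "?g (mul_op B x y) = mul_op A (?g x) (?g y)"
      by (simp_all only: gf)
  qed
  then have "alg_hom B A ?g"
    using f(1) g unfolding alg_hom_def by blast
  then show ?thesis
    using bij_betw_inv_into[OF f(2)] unfolding isomorphic_def by blast
qed

lemma homomorphic_image_trans:
  assumes "homomorphic_image C B" "homomorphic_image B A"
  shows "homomorphic_image C A"
proof -
  obtain f g where "alg_hom A B f" "f ` carr A = carr B" "alg_hom B C g" "g ` carr B = carr C"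
    using assms unfolding homomorphic_image_def by blast
  then have "alg_hom A C (g \<circ> f)" "(g \<circ> f) ` carr A = carr C"
    unfolding alg_hom_def Pi_iff image_comp [symmetric] by simp_all
  then show ?thesis unfolding homomorphic_image_def by blast
qed

lemma satisfies_isomorphic:
  assumes "isomorphic A B"
  shows "satisfies A e \<longleftrightarrow> satisfies B e"
  using satisfies_homomorphic_image[OF isomorphic_imp_homomorphic_image[OF assms]]
    satisfies_homomorphic_image[OF isomorphic_imp_homomorphic_image[OF isomorphic_sym[OF assms]]]
  by (rule iffI)

lemma isomorphic_copy:
  fixes A :: "'a algebra" and g :: "'a \<Rightarrow> 'b"
  assumes "is_algebra A" "inj_on g (carr A)"
  obtains B :: "'b algebra" where "isomorphic A B"
proof -
  let ?i = "inv_into (carr A) g"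
  let ?B = "\<lparr>carr = g ` carr A, add_op = (\<lambda>x y. g (add_op A (?i x) (?i y))),
             mul_op = (\<lambda>x y. g (mul_op A (?i x) (?i y)))\<rparr>"
  have "alg_hom A ?B g"
    using assms by (auto simp: alg_hom_def is_algebra_def)
  moreover have "bij_betw g (carr A) (carr ?B)"
    using assms(2) by (simp add: bij_betw_def)
  ultimately have "isomorphic A ?B" unfolding isomorphic_def by blast
  then show ?thesis by (rule that)
qed

lemma finite_isomorphic_copy:
  assumes "is_algebra A" "finite (carr A)"
  obtains B :: "('u::infinite) algebra" where "isomorphic A B"
proof -
  obtain f :: "nat \<Rightarrow> 'u" where "inj f"
    using infinite_UNIV infinite_countable_subset by blast
  moreover obtain g :: "'a \<Rightarrow> nat" where "inj_on g (carr A)"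
    using finite_imp_inj_to_nat_seg[OF assms(2)] by blast
  ultimately have "inj_on (f \<circ> g) (carr A)"
    by (simp add: comp_inj_on inj_on_subset)
  then show ?thesis using isomorphic_copy[OF assms(1)] that by blast
qed

lemma variety_models: "variety (models \<Sigma>)"
  unfolding variety_def
proof (intro conjI ballI allI impI)
  fix A B :: "'u algebra" assume A: "A \<in> models \<Sigma>"
  then show "is_algebra A" by (simp add: models_def)
  show "B \<in> models \<Sigma>" if "subalgebra B A"
    using A that satisfies_subalgebra[OF that] by (simp add: models_def subalgebra_def)
  show "B \<in> models \<Sigma>" if "homomorphic_image B A"
    using A that satisfies_homomorphic_image[OF that]
    by (auto simp: models_def homomorphic_image_def alg_hom_def)
next
  fix I :: "'u set" and F :: "'u \<Rightarrow> 'u algebra" and B :: "'u algebra" and C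
  assume *: "(\<forall>i\<in>I. F i \<in> models \<Sigma>) \<and> subalgebra C (direct_product I F) \<and> isomorphic C B"
  then have "is_algebra B" by (auto simp: isomorphic_def alg_hom_def)
  moreover have "satisfies B e" if "e \<in> \<Sigma>" for e
  proof -
    have "satisfies (direct_product I F) e"
      using * that by (intro satisfies_direct_product) (auto simp: models_def)
    then show ?thesis
      using * satisfies_subalgebra[of C] satisfies_isomorphic[of C B] by blast
  qed
  ultimately show "B \<in> models \<Sigma>" by (simp add: models_def)
qed


section \<open>Varieties are determined by their identities\<close>

text \<open>
  Terms whose variables range over the whole type of the algebras, so that every algebra over
  \<open>'u\<close> is a quotient of the free algebra on the generating set \<open>UNIV :: 'u set\<close>.
\<close>

datatype 'v gterm = GVar 'v | GPlus "'v gterm" "'v gterm" | GTimes "'v gterm" "'v gterm"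

primrec geval :: "'a algebra \<Rightarrow> ('v \<Rightarrow> 'a) \<Rightarrow> 'v gterm \<Rightarrow> 'a" where
  "geval A h (GVar x) = h x"
| "geval A h (GPlus s t) = add_op A (geval A h s) (geval A h t)"
| "geval A h (GTimes s t) = mul_op A (geval A h s) (geval A h t)"

primrec trm_of :: "('v \<Rightarrow> nat) \<Rightarrow> 'v gterm \<Rightarrow> trm" where
  "trm_of f (GVar x) = Var (f x)"
| "trm_of f (GPlus s t) = Plus (trm_of f s) (trm_of f t)"
| "trm_of f (GTimes s t) = Times (trm_of f s) (trm_of f t)"

lemma eval_trm_of: "eval_trm A h (trm_of f t) = geval A (h \<circ> f) t"
  by (induction t) auto

lemma geval_cong: "(\<And>x. x \<in> set_gterm t \<Longrightarrow> h x = k x) \<Longrightarrow> geval A h t = geval A k t"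
  by (induction t) auto

lemma finite_set_gterm: "finite (set_gterm t)"
  by (induction t) auto

lemma geval_closed:
  assumes "is_algebra A" "range h \<subseteq> carr A"
  shows "geval A h t \<in> carr A"
  using assms by (induction t) (auto simp: is_algebra_def)

text \<open>
  This is what keeps the free algebra, and the index set of the product containing it, inside
  \<open>'u\<close>: an infinite type absorbs its own square, and iterating a pairing function codes terms.
\<close>

lemma inj_gterm_code: "\<exists>c :: ('u::infinite) gterm \<Rightarrow> 'u. inj c"
proof -
  have "(card_of (UNIV \<times> UNIV :: ('u \<times> 'u) set), card_of (UNIV :: 'u set)) \<in> ordLeq"
    by (intro ordIso_imp_ordLeq card_of_Times_same_infinite infinite_UNIV)
  then obtain p :: "'u \<times> 'u \<Rightarrow> 'u" where p: "inj p"
    by (auto simp: card_of_ordLeq [symmetric])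
  obtain f :: "nat \<Rightarrow> 'u" where f: "inj f"
    using infinite_UNIV infinite_countable_subset by blast
  define c where "c = rec_gterm (\<lambda>x. p (f 0, x))
    (\<lambda>_ _ u v. p (f 1, p (u, v))) (\<lambda>_ _ u v. p (f 2, p (u, v)))"
  have [simp]: "p u = p v \<longleftrightarrow> u = v" "f m = f n \<longleftrightarrow> m = n" for u v m n
    using p f by (simp_all add: inj_eq)
  have "c s = c t \<Longrightarrow> s = t" for s t
  proof (induction s arbitrary: t)
    case (GVar x) then show ?case by (cases t) (auto simp: c_def)
  next
    case (GPlus s1 s2) then show ?case by (cases t) (auto simp: c_def)
  next
    case (GTimes s1 s2) then show ?case by (cases t) (auto simp: c_def)
  qed
  then have "inj c" by (rule injI)
  then show ?thesis by blast
qed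

text \<open>
  Birkhoff's theorem. For each pair of terms that some member of \<open>K\<close> separates, choose one
  such member with a separating assignment. In the product of the chosen algebras the diagonal
  assignment generates the relatively free algebra \<open>C\<close>: two terms agree there only if they
  agree in all of \<open>K\<close>. Hence an algebra satisfying the identities of \<open>K\<close> is an image of \<open>C\<close>.
\<close>

theorem variety_closed_under_identities:
  fixes K :: "('u::infinite) algebra set"
  assumes K: "variety K" and A: "is_algebra A"
    and ids: "\<And>e. (\<And>B. B \<in> K \<Longrightarrow> satisfies B e) \<Longrightarrow> satisfies A e"
  shows "A \<in> K"
proof -
  \<comment> \<open>The pair of two terms is itself coded as a term, so that one coding of terms also
    provides the indices.\<close>
  obtain c :: "'u gterm \<Rightarrow> 'u" where c: "inj c" using inj_gterm_code by blast
  define key where "key = (\<lambda>(s, t). c (GPlus (GVar (c s)) (GVar (c t))))"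
  have key: "inj key" using c by (auto simp: key_def inj_def)
  define bad where "bad = {(s :: 'u gterm, t).
    \<exists>B h. B \<in> K \<and> range h \<subseteq> carr B \<and> geval B h s \<noteq> geval B h t}"
  have "\<forall>q. \<exists>B h. q \<in> bad \<longrightarrow> B \<in> K \<and> range h \<subseteq> carr B \<and> geval B h (fst q) \<noteq> geval B h (snd q)"
    by (auto simp: bad_def)
  then obtain B h where Bh: "\<And>q. q \<in> bad \<Longrightarrow>
      B q \<in> K \<and> range (h q) \<subseteq> carr (B q) \<and> geval (B q) (h q) (fst q) \<noteq> geval (B q) (h q) (snd q)"
    by metis
  define I where "I = key ` bad"
  define F where "F i = B (inv key i)" for i
  define P where "P = direct_product I F"
  define gen where "gen x = (\<lambda>i\<in>I. h (inv key i) x)" for x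
  have F: "F i \<in> K" "is_algebra (F i)" "range (h (inv key i)) \<subseteq> carr (F i)" if "i \<in> I" for i
  proof -
    obtain q where q: "q \<in> bad" "i = key q" using \<open>i \<in> I\<close> unfolding I_def by blast
    have [simp]: "inv key i = q" using key q(2) by simp
    show "F i \<in> K" "range (h (inv key i)) \<subseteq> carr (F i)"
      using Bh[OF q(1)] by (simp_all add: F_def)
    then show "is_algebra (F i)" using K unfolding variety_def by blast
  qed
  have P: "is_algebra P"
  proof -
    have "carr P \<noteq> {}"
      using F(2) by (simp add: P_def direct_product_def PiE_eq_empty_iff is_algebra_def)
    moreover have "add_op P x y \<in> carr P \<and> mul_op P x y \<in> carr P"
      if "x \<in> carr P" "y \<in> carr P" for x y
    proof -
      have "x i \<in> carr (F i)" "y i \<in> carr (F i)" if "i \<in> I" for i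
        using \<open>x \<in> carr P\<close> \<open>y \<in> carr P\<close> that
        unfolding P_def direct_product_def by (auto dest: PiE_mem)
      then show ?thesis
        using F(2) by (simp add: P_def direct_product_def is_algebra_def)
    qed
    ultimately show ?thesis by (simp add: is_algebra_def)
  qed
  have "range gen \<subseteq> carr P"
    using F(3) by (auto simp: gen_def P_def direct_product_def image_subset_iff)
  note gP = geval_closed[OF P this]
  have evP: "geval P gen t = (\<lambda>i\<in>I. geval (F i) (h (inv key i)) t)" for t
  proof (induction t)
    case (GVar x)
    show ?case by (simp add: gen_def)
  qed (simp_all add: P_def direct_product_def cong: restrict_cong)
  define C where "C = \<lparr>carr = range (geval P gen), add_op = add_op P, mul_op = mul_op P\<rparr>"
  have "add_op P x y \<in> carr C \<and> mul_op P x y \<in> carr C"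
    if x: "x \<in> carr C" and y: "y \<in> carr C" for x y
  proof -
    obtain s t where "x = geval P gen s" "y = geval P gen t"
      using x y unfolding C_def by auto
    then have "add_op P x y = geval P gen (GPlus s t)" "mul_op P x y = geval P gen (GTimes s t)"
      by simp_all
    then show ?thesis by (simp add: C_def del: geval.simps)
  qed
  then have C: "subalgebra C P"
    using gP unfolding subalgebra_def is_algebra_def by (simp add: C_def image_subset_iff)
  define rep where "rep y = (SOME t. geval P gen t = y)" for y
  have rep: "geval P gen (rep y) = y" if "y \<in> carr C" for y
    using that unfolding C_def rep_def by (auto intro: someI_ex)
  have "inj_on (c \<circ> rep) (carr C)"
    by (intro inj_onI) (metis c comp_apply injD rep)
  then obtain D :: "'u algebra" where D: "isomorphic C D"
    using isomorphic_copy C by (metis subalgebra_def)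
  have "D \<in> K"
    using K F(1) C D unfolding variety_def P_def by blast
  obtain a0 where a0: "a0 \<in> carr A" using A by (auto simp: is_algebra_def)
  define k where "k x = (if x \<in> carr A then x else a0)" for x
  have k: "range k \<subseteq> carr A" using a0 by (auto simp: k_def)
  have wd: "geval A k s = geval A k t" if "geval P gen s = geval P gen t" for s t
  proof -
    have "(s, t) \<notin> bad"
    proof
      assume q: "(s, t) \<in> bad"
      then have "key (s, t) \<in> I" by (simp add: I_def)
      from fun_cong[OF that, of "key (s, t)"] this key
      have "geval (B (s, t)) (h (s, t)) s = geval (B (s, t)) (h (s, t)) t"
        by (simp add: evP F_def inv_f_f)
      then show False using Bh[OF q] by simp
    qed
    then have eq: "geval E l s = geval E l t" if "E \<in> K" "range l \<subseteq> carr E" for E l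
      using that by (auto simp: bad_def)
    \<comment> \<open>Only the finitely many variables of the two terms have to be renamed to numbers.\<close>
    let ?X = "set_gterm s \<union> set_gterm t"
    obtain f :: "'u \<Rightarrow> nat" where f: "inj_on f ?X"
      using finite_imp_inj_to_nat_seg[of ?X] finite_set_gterm by blast
    have "satisfies A (trm_of f s, trm_of f t)"
    proof (rule ids)
      fix E assume "E \<in> K"
      then show "satisfies E (trm_of f s, trm_of f t)"
        using eq[of E] by (simp add: satisfies_def eval_trm_of image_subset_iff)
    qed
    moreover have "range (k \<circ> inv_into ?X f) \<subseteq> carr A" using k by auto
    ultimately have "geval A (k \<circ> inv_into ?X f \<circ> f) s = geval A (k \<circ> inv_into ?X f \<circ> f) t"
      by (simp only: satisfies_def eval_trm_of fst_conv snd_conv)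
    moreover have "geval A (k \<circ> inv_into ?X f \<circ> f) u = geval A k u" if "set_gterm u \<subseteq> ?X" for u
      using that f by (intro geval_cong) (simp add: subset_iff)
    ultimately show ?thesis by simp
  qed
  have "homomorphic_image A C"
    unfolding homomorphic_image_def
  proof (intro exI conjI)
    let ?\<phi> = "\<lambda>y. geval A k (rep y)"
    have \<phi>: "?\<phi> (geval P gen t) = geval A k t" for t
      by (rule wd) (auto intro: rep simp: C_def)
    have "?\<phi> (add_op P x y) = add_op A (?\<phi> x) (?\<phi> y) \<and> ?\<phi> (mul_op P x y) = mul_op A (?\<phi> x) (?\<phi> y)"
      if xy: "x \<in> carr C" "y \<in> carr C" for x y
      using \<phi>[of "GPlus (rep x) (rep y)"] \<phi>[of "GTimes (rep x) (rep y)"] rep[OF xy(1)] rep[OF xy(2)]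
      by simp
    then show "alg_hom C A ?\<phi>"
      using C A geval_closed[OF A k] by (auto simp: alg_hom_def subalgebra_def C_def)
    show "?\<phi> ` carr C = carr A"
    proof
      show "?\<phi> ` carr C \<subseteq> carr A" using geval_closed[OF A k] by auto
      show "carr A \<subseteq> ?\<phi> ` carr C"
      proof
        fix a assume "a \<in> carr A"
        then have "a = ?\<phi> (geval P gen (GVar a))" by (simp only: \<phi>) (simp add: k_def)
        moreover have "geval P gen (GVar a) \<in> carr C" unfolding C_def by (simp del: geval.simps)
        ultimately show "a \<in> ?\<phi> ` carr C" by (rule image_eqI)
      qed
    qed
  qed
  then have "homomorphic_image A D"
    using homomorphic_image_trans isomorphic_imp_homomorphic_image[OF isomorphic_sym[OF D]] by blast
  moreover have "\<forall>B\<in>K. \<forall>B'. homomorphic_image B' B \<longrightarrow> B' \<in> K"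
    using K unfolding variety_def by (elim conjE)
  ultimately show ?thesis using \<open>D \<in> K\<close> by blast
qed


section \<open>Odd walks and proper 2-colourings\<close>

inductive odd_walk :: "('a \<times> 'a) set \<Rightarrow> 'a \<Rightarrow> 'a \<Rightarrow> bool" for E where
  edge: "(x, y) \<in> E \<union> E\<inverse> \<Longrightarrow> odd_walk E x y"
| extend: "odd_walk E x y \<Longrightarrow> (y, z) \<in> E \<union> E\<inverse> \<Longrightarrow> (z, w) \<in> E \<union> E\<inverse> \<Longrightarrow> odd_walk E x w"

definition proper_colouring :: "('a \<times> 'a) set \<Rightarrow> ('a \<Rightarrow> bool) \<Rightarrow> bool" where
  "proper_colouring E c \<longleftrightarrow> (\<forall>(x, y)\<in>E. c x \<noteq> c y)"

lemma odd_walk_colours: "odd_walk E x y \<Longrightarrow> proper_colouring E c \<Longrightarrow> c x \<noteq> c y"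
proof (induction rule: odd_walk.induct)
  case (extend x y z w)
  then have "c y \<noteq> c z" "c z \<noteq> c w" by (auto simp: proper_colouring_def)
  then show ?case using extend by auto
qed (auto simp: proper_colouring_def)

text \<open>
  Odd walks compose in threes, because three odd lengths have an odd sum. This makes the
  relation symmetric and, on a bipartite graph, describes the pairs of vertices that lie in
  one component on opposite sides.
\<close>

lemma odd_walk_trans_edge:
  "odd_walk E y z \<Longrightarrow> odd_walk E x y \<Longrightarrow> (z, w) \<in> E \<union> E\<inverse> \<Longrightarrow> odd_walk E x w"
proof (induction arbitrary: w rule: odd_walk.induct)
  case (edge y z)
  show ?case by (rule odd_walk.extend[OF edge.prems(1) edge.hyps edge.prems(2)])
next
  case (extend y z z' z'')
  show ?case
    by (rule odd_walk.extend[OF extend.IH[OF extend.prems(1) extend.hyps(2)] extend.hyps(3) extend.prems(2)])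
qed

lemma odd_walk_trans: "odd_walk E z w \<Longrightarrow> odd_walk E x y \<Longrightarrow> odd_walk E y z \<Longrightarrow> odd_walk E x w"
proof (induction rule: odd_walk.induct)
  case (edge z w)
  show ?case by (rule odd_walk_trans_edge[OF edge.prems(2,1) edge.hyps])
next
  case (extend z w w' w'')
  show ?case by (rule odd_walk.extend[OF extend.IH[OF extend.prems] extend.hyps(2,3)])
qed

lemma odd_walk_sym: "odd_walk E x y \<Longrightarrow> odd_walk E y x"
proof (induction rule: odd_walk.induct)
  case (edge x y)
  then show ?case by (auto intro: odd_walk.edge)
next
  case (extend x y z w)
  have "odd_walk E w z" "odd_walk E z y" using extend.hyps by (auto intro: odd_walk.edge)
  then show ?case by (rule odd_walk_trans[OF extend.IH])
qed

lemma odd_walk_Field: "odd_walk E x y \<Longrightarrow> x \<in> Field E \<and> y \<in> Field E"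
  by (induction rule: odd_walk.induct) (auto simp: Field_def)

text \<open>
  Without closed odd walks the graph is bipartite, and two vertices not joined by an odd walk
  can be given the same colour: they lie on the same side of one component or in different
  components, whose colourings are independent. Taking \<open>x = y\<close> gives the existence of a
  colouring.
\<close>

lemma proper_colouring_equal_at:
  assumes "\<And>z. \<not> odd_walk E z z" "\<not> odd_walk E x y"
  obtains c where "proper_colouring E c" "c x = c y"
proof -
  \<comment> \<open>Colour each vertex by the parity of its distance from a representative of its component;
    choosing x and y themselves as representatives makes both colours False.\<close>
  define R where "R = (E \<union> E\<inverse>)\<^sup>*"
  define rep where "rep w = (if (x, w) \<in> R then x else if (y, w) \<in> R then y else SOME v. (v, w) \<in> R)" for w
  define c where "c w = odd_walk E (rep w) w" for w
  have walk: "r = u \<or> odd_walk E r u \<or> (\<exists>z. odd_walk E r z \<and> (z, u) \<in> E \<union> E\<inverse>)" if "(r, u) \<in> R" for r u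
    using that unfolding R_def
  proof (induction rule: rtrancl_induct)
    case (step u v)
    from step.IH show ?case
    proof (elim disjE exE conjE)
      assume "r = u"
      then show ?thesis using odd_walk.edge[OF step.hyps(2)] by simp
    next
      assume "odd_walk E r u"
      then show ?thesis using step.hyps(2) by blast
    next
      fix z assume "odd_walk E r z" "(z, u) \<in> E \<union> E\<inverse>"
      then show ?thesis using odd_walk.extend[OF _ _ step.hyps(2)] by simp
    qed
  qed simp
  have R: "(w, u) \<in> R \<longleftrightarrow> (w, v) \<in> R" if "(u, v) \<in> E" for u v w
  proof
    have uv: "(u, v) \<in> E \<union> E\<inverse>" "(v, u) \<in> E \<union> E\<inverse>" using that by auto
    show "(w, u) \<in> R \<Longrightarrow> (w, v) \<in> R" unfolding R_def by (rule rtrancl.rtrancl_into_rtrancl[OF _ uv(1)])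
    show "(w, v) \<in> R \<Longrightarrow> (w, u) \<in> R" unfolding R_def by (rule rtrancl.rtrancl_into_rtrancl[OF _ uv(2)])
  qed
  have "(w, w) \<in> R" for w by (simp add: R_def)
  then have rep: "(rep w, w) \<in> R" for w
    unfolding rep_def by (auto intro: someI[of "\<lambda>v. (v, w) \<in> R"])
  have "c u \<noteq> c v" if uv: "(u, v) \<in> E" for u v
  proof -
    have eq: "rep u = rep v" using R[OF uv] by (simp add: rep_def)
    have "c u \<or> c v"
      using walk[OF rep[of u]]
    proof (elim disjE exE conjE)
      assume "rep u = u"
      then show ?thesis using odd_walk.edge[of u v E] uv eq by (simp add: c_def)
    next
      fix z assume "odd_walk E (rep u) z" "(z, u) \<in> E \<union> E\<inverse>"
      then show ?thesis using odd_walk.extend[of E "rep u" z u v] uv eq by (simp add: c_def)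
    qed (simp add: c_def)
    moreover have "\<not> (c u \<and> c v)"
    proof
      assume "c u \<and> c v"
      then have "odd_walk E (rep u) u" "odd_walk E v (rep u)"
        using odd_walk_sym unfolding c_def eq by auto
      moreover have "odd_walk E u v" using uv by (auto intro: odd_walk.edge)
      ultimately show False using assms(1) odd_walk_trans[of E v "rep u" "rep u" u] by simp
    qed
    ultimately show ?thesis by blast
  qed
  then have "proper_colouring E c" by (auto simp: proper_colouring_def)
  moreover have "\<not> c x" using assms(1) by (simp add: c_def rep_def R_def)
  moreover have "\<not> c y" using assms by (simp add: c_def rep_def R_def)
  ultimately show ?thesis using that by blast
qed


section \<open>Words of a term\<close>

text \<open>
  By distributivity a term is a sum of words. The words of length one and two are recorded as
  sets of variables and of edges, the latter with an arbitrary orientation; \<open>big\<close> says that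
  some word has length at least three.
\<close>

primrec lin :: "trm \<Rightarrow> nat set" where
  "lin (Var n) = {n}"
| "lin (Plus s t) = lin s \<union> lin t"
| "lin (Times s t) = {}"

primrec quad :: "trm \<Rightarrow> (nat \<times> nat) set" where
  "quad (Var n) = {}"
| "quad (Plus s t) = quad s \<union> quad t"
| "quad (Times s t) = lin s \<times> lin t"

primrec big :: "trm \<Rightarrow> bool" where
  "big (Var n) = False"
| "big (Plus s t) = (big s \<or> big t)"
| "big (Times s t) = (big s \<or> big t \<or> quad s \<noteq> {} \<or> quad t \<noteq> {})"

lemma term_has_word: "lin t \<noteq> {} \<or> quad t \<noteq> {} \<or> big t"
  by (induction t) auto

lemma finite_quad: "finite (lin t) \<and> finite (quad t)"
  by (induction t) auto

text \<open>
  In SR6 these are the terms with constant value \<open>1\<close>. A value other than \<open>1\<close> would force every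
  edge to be worth \<open>3\<close>, which splits its endpoints between \<open>{2, 5}\<close> and \<open>{4, 6}\<close> and hence
  colours the graph with two colours.
\<close>

definition degenerate :: "trm \<Rightarrow> bool" where
  "degenerate t \<longleftrightarrow> big t \<or> lin t \<inter> Field (quad t) \<noteq> {} \<or> (\<exists>x. odd_walk (quad t) x x)"

lemma colouring_of_nondegenerate:
  assumes "\<not> degenerate t"
  obtains c where "proper_colouring (quad t) c"
  using assms proper_colouring_equal_at[of "quad t" undefined undefined] by (auto simp: degenerate_def)


section \<open>Nilpotent semirings\<close>

text \<open>
  A commutative ai-semiring in which products of three factors, squares, and sums \<open>a + ab\<close> all
  equal one element that absorbs under addition. These laws hold in SR6; the laws that its odd
  cycles satisfy are deliberately left out.
\<close>

locale nil_semiring =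
  fixes A :: "'a algebra" and zero :: 'a
  assumes alg: "is_algebra A"
    and add_idem: "a \<in> carr A \<Longrightarrow> add_op A a a = a"
    and add_comm: "a \<in> carr A \<Longrightarrow> b \<in> carr A \<Longrightarrow> add_op A a b = add_op A b a"
    and add_assoc: "a \<in> carr A \<Longrightarrow> b \<in> carr A \<Longrightarrow> c \<in> carr A \<Longrightarrow>
      add_op A (add_op A a b) c = add_op A a (add_op A b c)"
    and mul_comm: "a \<in> carr A \<Longrightarrow> b \<in> carr A \<Longrightarrow> mul_op A a b = mul_op A b a"
    and distrib: "a \<in> carr A \<Longrightarrow> b \<in> carr A \<Longrightarrow> c \<in> carr A \<Longrightarrow>
      mul_op A a (add_op A b c) = add_op A (mul_op A a b) (mul_op A a c)"
    and cube: "a \<in> carr A \<Longrightarrow> b \<in> carr A \<Longrightarrow> c \<in> carr A \<Longrightarrow> mul_op A a (mul_op A b c) = zero"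
    and add_zero: "a \<in> carr A \<Longrightarrow> add_op A a zero = zero"
    and square: "a \<in> carr A \<Longrightarrow> mul_op A a a = zero"
    and add_mul: "a \<in> carr A \<Longrightarrow> b \<in> carr A \<Longrightarrow> add_op A a (mul_op A a b) = zero"
begin

definition le :: "'a \<Rightarrow> 'a \<Rightarrow> bool" (infix "\<preceq>" 50) where
  "a \<preceq> b \<longleftrightarrow> add_op A a b = b"

lemma closed [simp]:
  "a \<in> carr A \<Longrightarrow> b \<in> carr A \<Longrightarrow> add_op A a b \<in> carr A"
  "a \<in> carr A \<Longrightarrow> b \<in> carr A \<Longrightarrow> mul_op A a b \<in> carr A"
  using alg by (auto simp: is_algebra_def)

lemma zero_closed [simp]: "zero \<in> carr A"
proof -
  obtain a where "a \<in> carr A" using alg by (auto simp: is_algebra_def)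
  then show ?thesis using square[of a] closed(2)[of a a] by simp
qed

lemma eval_in_carr [simp]: "range h \<subseteq> carr A \<Longrightarrow> eval_trm A h t \<in> carr A"
  by (induction t) auto

lemma le_refl [simp]: "a \<in> carr A \<Longrightarrow> a \<preceq> a"
  by (simp add: le_def add_idem)

lemma le_zero [simp]: "a \<in> carr A \<Longrightarrow> a \<preceq> zero"
  by (simp add: le_def add_zero)

lemma zero_le [simp]: "a \<in> carr A \<Longrightarrow> zero \<preceq> a \<longleftrightarrow> a = zero"
  using add_comm[of a zero] add_zero[of a] by (auto simp: le_def)

lemma le_antisym: "a \<in> carr A \<Longrightarrow> b \<in> carr A \<Longrightarrow> a \<preceq> b \<Longrightarrow> b \<preceq> a \<Longrightarrow> a = b"
  using add_comm[of a b] by (simp add: le_def)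

lemma le_trans: "a \<in> carr A \<Longrightarrow> b \<in> carr A \<Longrightarrow> c \<in> carr A \<Longrightarrow> a \<preceq> b \<Longrightarrow> b \<preceq> c \<Longrightarrow> a \<preceq> c"
  using add_assoc[of a b c] by (simp add: le_def)

lemma le_add:
  assumes "a \<in> carr A" "b \<in> carr A"
  shows "a \<preceq> add_op A a b" "b \<preceq> add_op A a b"
proof -
  have *: "u \<preceq> add_op A u v" if "u \<in> carr A" "v \<in> carr A" for u v
    unfolding le_def using that by (subst add_assoc [symmetric]) (simp_all add: add_idem)
  show "a \<preceq> add_op A a b" using assms by (rule *)
  show "b \<preceq> add_op A a b" using *[OF assms(2,1)] add_comm[OF assms] by argo
qed

lemma add_le:
  assumes "a \<in> carr A" "b \<in> carr A" "c \<in> carr A"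
  shows "add_op A a b \<preceq> c \<longleftrightarrow> a \<preceq> c \<and> b \<preceq> c"
proof
  assume *: "add_op A a b \<preceq> c"
  show "a \<preceq> c \<and> b \<preceq> c"
    using le_trans[OF _ _ _ le_add(1) *] le_trans[OF _ _ _ le_add(2) *] assms by simp
next
  assume "a \<preceq> c \<and> b \<preceq> c"
  then show "add_op A a b \<preceq> c" using add_assoc[OF assms] by (simp add: le_def)
qed

lemma eq_iff_upper:
  assumes "a \<in> carr A" "b \<in> carr A" "\<And>c. c \<in> carr A \<Longrightarrow> a \<preceq> c \<longleftrightarrow> b \<preceq> c"
  shows "a = b"
proof (rule le_antisym)
  show "a \<preceq> b" using assms(3)[OF assms(2)] assms(2) by simp
  show "b \<preceq> a" using assms(3)[OF assms(1)] assms(1) by simp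
qed (use assms in auto)

lemma mul_zero [simp]: "a \<in> carr A \<Longrightarrow> mul_op A a zero = zero" "a \<in> carr A \<Longrightarrow> mul_op A zero a = zero"
proof -
  show "mul_op A a zero = zero" if "a \<in> carr A" for a
    using cube[OF that that that] square[OF that] by simp
  then show "mul_op A zero a = zero" if "a \<in> carr A"
    using mul_comm[OF that zero_closed] that by metis
qed

text \<open>
  Multiplying by a fixed element kills all words of length at least two, so only the linear
  words matter. This is the multiplication step in the proof of the next lemma.
\<close>

lemma mul_eval_le:
  assumes h: "range h \<subseteq> carr A" and d: "d \<in> carr A" and c: "c \<in> carr A"
  shows "mul_op A d (eval_trm A h t) \<preceq> c \<longleftrightarrow>
    (\<forall>x\<in>lin t. mul_op A d (h x) \<preceq> c) \<and> (quad t \<noteq> {} \<or> big t \<longrightarrow> c = zero)"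
proof (induction t)
  case (Plus s t)
  then show ?case using h d c by (auto simp: distrib add_le)
next
  case (Times s t)
  then show ?case using h d c term_has_word[of s] term_has_word[of t] by (auto simp: cube)
qed simp

text \<open>
  The value of a term is the supremum of the values of its words. Upper bounds are easier to
  handle than sums over sets of words, and by antisymmetry they determine the value.
\<close>

lemma eval_le:
  assumes h: "range h \<subseteq> carr A" and c: "c \<in> carr A"
  shows "eval_trm A h t \<preceq> c \<longleftrightarrow> (\<forall>x\<in>lin t. h x \<preceq> c) \<and>
    (\<forall>(x, y)\<in>quad t. mul_op A (h x) (h y) \<preceq> c) \<and> (big t \<longrightarrow> c = zero)"
proof (induction t)
  case (Plus s t)
  then show ?case using h c by (auto simp: add_le)
next
  case (Times s t)
  have hx: "h x \<in> carr A" for x using h by auto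
  let ?s = "eval_trm A h s" and ?t = "eval_trm A h t"
  have "eval_trm A h (Times s t) \<preceq> c \<longleftrightarrow> mul_op A ?t ?s \<preceq> c"
    using mul_comm[of ?s ?t] h by (simp only: eval_trm.simps eval_in_carr)
  also have "\<dots> \<longleftrightarrow> (\<forall>x\<in>lin s. mul_op A ?t (h x) \<preceq> c) \<and> (quad s \<noteq> {} \<or> big s \<longrightarrow> c = zero)"
    using h by (intro mul_eval_le c) simp_all
  also have "\<dots> \<longleftrightarrow> (\<forall>x\<in>lin s. mul_op A (h x) ?t \<preceq> c) \<and> (quad s \<noteq> {} \<or> big s \<longrightarrow> c = zero)"
    using mul_comm[of ?t] h hx by (simp only: eval_in_carr)
  also have "\<dots> \<longleftrightarrow> (\<forall>x\<in>lin s. (\<forall>y\<in>lin t. mul_op A (h x) (h y) \<preceq> c) \<and>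
      (quad t \<noteq> {} \<or> big t \<longrightarrow> c = zero)) \<and> (quad s \<noteq> {} \<or> big s \<longrightarrow> c = zero)"
    by (simp only: mul_eval_le[OF h hx c])
  also have "\<dots> \<longleftrightarrow> (\<forall>x\<in>lin (Times s t). h x \<preceq> c) \<and>
    (\<forall>(x, y)\<in>quad (Times s t). mul_op A (h x) (h y) \<preceq> c) \<and> (big (Times s t) \<longrightarrow> c = zero)"
    using term_has_word[of s] term_has_word[of t] le_zero[OF closed(2)[OF hx hx]] by auto
  finally show ?case .
qed simp

lemma word_le_eval:
  assumes h: "range h \<subseteq> carr A"
  shows "x \<in> lin t \<Longrightarrow> h x \<preceq> eval_trm A h t"
    and "(x, y) \<in> quad t \<Longrightarrow> mul_op A (h x) (h y) \<preceq> eval_trm A h t"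
    and "big t \<Longrightarrow> eval_trm A h t = zero"
  using eval_le[OF h, of "eval_trm A h t" t] h by auto

lemma eval_lin_quad_cong:
  assumes h: "range h \<subseteq> carr A"
    and "lin s = lin t" "quad s \<union> (quad s)\<inverse> = quad t \<union> (quad t)\<inverse>" "\<not> big s" "\<not> big t"
  shows "eval_trm A h s = eval_trm A h t"
proof (rule eq_iff_upper)
  fix c assume c: "c \<in> carr A"
  have hx: "h x \<in> carr A" for x using h by auto
  have "(\<forall>(x, y)\<in>quad u. mul_op A (h x) (h y) \<preceq> c) \<longleftrightarrow>
    (\<forall>(x, y)\<in>quad u \<union> (quad u)\<inverse>. mul_op A (h x) (h y) \<preceq> c)" for u
    using hx by (auto simp: mul_comm)
  then show "eval_trm A h s \<preceq> c \<longleftrightarrow> eval_trm A h t \<preceq> c"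
    using assms by (simp add: eval_le[OF h c])
qed (use h in auto)

lemma lin_meets_quad_zero:
  assumes h: "range h \<subseteq> carr A" and "lin t \<inter> Field (quad t) \<noteq> {}"
  shows "eval_trm A h t = zero"
proof -
  have hx: "h x \<in> carr A" for x using h by auto
  obtain x y where x: "x \<in> lin t" and "(x, y) \<in> quad t \<or> (y, x) \<in> quad t"
    using assms(2) by (auto simp: Field_def)
  then have "mul_op A (h x) (h y) \<preceq> eval_trm A h t"
    using word_le_eval(2)[OF h] hx by (metis mul_comm)
  then have "add_op A (h x) (mul_op A (h x) (h y)) \<preceq> eval_trm A h t"
    using word_le_eval(1)[OF h x] h hx by (simp add: add_le)
  then show ?thesis using h hx by (simp add: add_mul)
qed

text \<open>
  The laws \<open>null\<close> and \<open>path_law\<close> define the two proper subvarieties that have a nontrivial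
  member. In a sum of products, \<open>path_law\<close> closes a path \<open>a - b - c - d\<close> by the edge \<open>a - d\<close>
  and so completes every component of the graph to a complete bipartite graph.
\<close>

definition null :: bool where
  "null \<longleftrightarrow> (\<forall>a\<in>carr A. \<forall>b\<in>carr A. mul_op A a b = zero)"

definition path_law :: bool where
  "path_law \<longleftrightarrow> (\<forall>a\<in>carr A. \<forall>b\<in>carr A. \<forall>c\<in>carr A. \<forall>d\<in>carr A. \<forall>e\<in>carr A.
     mul_op A a b \<preceq> e \<longrightarrow> mul_op A b c \<preceq> e \<longrightarrow> mul_op A c d \<preceq> e \<longrightarrow> mul_op A a d \<preceq> e)"

text \<open>
  Each extension of a walk by two edges is one use of the path law: the induction replaces the
  walk to \<open>y\<close> by a single edge, which together with the two new edges forms a path of length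
  three.
\<close>

lemma path_law_odd_walk:
  assumes path_law and h: "range h \<subseteq> carr A"
    and "odd_walk (quad t) x y" and e: "e \<in> carr A" "eval_trm A h t \<preceq> e"
  shows "mul_op A (h x) (h y) \<preceq> e"
proof -
  have hx: "h x \<in> carr A" for x using h by auto
  have "mul_op A (h x) (h y) \<preceq> e" if "(x, y) \<in> quad t" for x y
    using that e eval_le[OF h e(1), of t] by blast
  then have edges: "mul_op A (h x) (h y) \<preceq> e" if "(x, y) \<in> quad t \<union> (quad t)\<inverse>" for x y
    using that mul_comm[OF hx hx, of x y] by (metis UnE converseD)
  from assms(3) show ?thesis
  proof (induction rule: odd_walk.induct)
    case (edge x y)
    then show ?case by (rule edges)
  next
    case (extend x y z w)
    then show ?case
      using edges[of y z] edges[of z w] assms(1) hx e(1) unfolding path_law_def by blast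
  qed
qed

text \<open>
  A closed odd walk at \<open>x\<close> puts the square of the value of \<open>x\<close>, that is, the absorbing
  element, below the sum. So the path law makes all odd cycles vanish at once.
\<close>

lemma path_law_degenerate:
  assumes path_law "range h \<subseteq> carr A" "degenerate t"
  shows "eval_trm A h t = zero"
proof -
  have hx: "h x \<in> carr A" for x using assms(2) by auto
  have "eval_trm A h t = zero" if "odd_walk (quad t) x x" for x
    using path_law_odd_walk[OF assms(1,2) that, of "eval_trm A h t"] assms(2) hx by (simp add: square)
  then show ?thesis
    using assms lin_meets_quad_zero word_le_eval(3) unfolding degenerate_def by blast
qed

lemma path_law_eval_eq:
  assumes path_law and h: "range h \<subseteq> carr A"
    and "\<not> big s" "\<not> big t" "lin s = lin t"
    and "\<And>x y. (x, y) \<in> quad s \<Longrightarrow> odd_walk (quad t) x y"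
    and "\<And>x y. (x, y) \<in> quad t \<Longrightarrow> odd_walk (quad s) x y"
  shows "eval_trm A h s = eval_trm A h t"
proof -
  have *: "eval_trm A h u \<preceq> c" if "lin u = lin v" "\<not> big u" "\<And>x y. (x, y) \<in> quad u \<Longrightarrow> odd_walk (quad v) x y"
    "eval_trm A h v \<preceq> c" "c \<in> carr A" for u v c
    using that path_law_odd_walk[OF assms(1) h _ that(5,4)] eval_le[OF h that(5)] by auto
  show ?thesis
    by (rule eq_iff_upper) (use * [of s t] * [of t s] assms h in auto)
qed

lemma null_eval_eq:
  assumes null and h: "range h \<subseteq> carr A"
    and "big s \<or> quad s \<noteq> {} \<longleftrightarrow> big t \<or> quad t \<noteq> {}"
    and "big s \<or> quad s \<noteq> {} \<or> lin s = lin t"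
  shows "eval_trm A h s = eval_trm A h t"
proof -
  have hx: "h x \<in> carr A" for x using h by auto
  have "eval_trm A h u = zero" if "big u \<or> quad u \<noteq> {}" for u
  proof (cases "big u")
    case True
    then show ?thesis using h by (rule_tac word_le_eval(3))
  next
    case False
    then obtain x y where "(x, y) \<in> quad u"
      using \<open>big u \<or> quad u \<noteq> {}\<close> by fastforce
    then show ?thesis
      using word_le_eval(2)[OF h, of x y u] h hx \<open>null\<close> by (simp add: null_def)
  qed
  moreover have "eval_trm A h s = eval_trm A h t" if "\<not> (big s \<or> quad s \<noteq> {})"
    using that assms by (intro eval_lin_quad_cong) auto
  ultimately show ?thesis using assms(3) by metis
qed

text \<open>
  Mapping the two colour classes to \<open>a\<close> and \<open>b\<close> collapses a bipartite graph to one edge; the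
  linear variables are sent to \<open>ab\<close> as well. A bipartite term that vanishes under such an
  assignment therefore yields \<open>ab = 0\<close>.
\<close>

lemma coloured_eval_le:
  assumes h: "range h \<subseteq> carr A" and "\<not> big t" and "proper_colouring (quad t) c"
    and ab: "a \<in> carr A" "b \<in> carr A"
    and "\<And>x. x \<in> Field (quad t) \<Longrightarrow> h x = (if c x then a else b)"
    and "\<And>x. x \<in> lin t \<Longrightarrow> h x = mul_op A a b"
  shows "eval_trm A h t \<preceq> mul_op A a b"
proof -
  have "mul_op A (h x) (h y) = mul_op A a b" if "(x, y) \<in> quad t" for x y
  proof -
    have "x \<in> Field (quad t)" "y \<in> Field (quad t)" "c x \<noteq> c y"
      using that assms(3) by (auto simp: Field_def proper_colouring_def)
    then show ?thesis using assms(6) ab by (auto simp: mul_comm)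
  qed
  then show ?thesis using assms(2,7) ab by (auto simp: eval_le[OF h])
qed

lemma mul_zero_of_coloured_eval:
  assumes h: "range h \<subseteq> carr A" and "\<not> big t" and "proper_colouring (quad t) c"
    and ab: "a \<in> carr A" "b \<in> carr A"
    and "\<And>x. x \<in> Field (quad t) \<Longrightarrow> h x = (if c x then a else b)"
    and "\<And>x. x \<in> lin t \<Longrightarrow> h x = mul_op A a b"
    and "eval_trm A h t = zero"
  shows "mul_op A a b = zero"
  using coloured_eval_le[OF assms(1-7)] assms(8) ab by simp

end


section \<open>Semirings in which non-bipartite sums vanish\<close>

text \<open>
  The algebras considered in this part are those in which every term that vanishes identically
  in SR6 vanishes. An identity that distinguishes words of its two sides is here exploited
  through substitutions until it produces the law \<open>null\<close> or the law \<open>path_law\<close>.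
\<close>

locale bipartite_semiring = nil_semiring +
  assumes degenerate_zero: "range h \<subseteq> carr A \<Longrightarrow> degenerate t \<Longrightarrow> eval_trm A h t = zero"
begin

lemma null_of_zero_term:
  assumes t: "\<not> degenerate t" and zero: "\<And>h. range h \<subseteq> carr A \<Longrightarrow> eval_trm A h t = zero"
  shows null
  unfolding null_def
proof (intro ballI)
  fix a b assume ab: "a \<in> carr A" "b \<in> carr A"
  obtain c where c: "proper_colouring (quad t) c" using colouring_of_nondegenerate[OF t] .
  define h where "h x = (if x \<in> Field (quad t) then if c x then a else b else mul_op A a b)" for x
  have h: "range h \<subseteq> carr A" using ab by (auto simp: h_def)
  show "mul_op A a b = zero"
    by (rule mul_zero_of_coloured_eval[OF h _ c ab _ _ zero[OF h]])
      (use t in \<open>auto simp: degenerate_def h_def\<close>)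
qed

lemma null_of_vanishing_variable:
  assumes t: "\<not> degenerate t" and x: "x \<notin> Field (quad t)" "x \<notin> lin t"
    and zero: "\<And>h. range h \<subseteq> carr A \<Longrightarrow> h x = zero \<Longrightarrow> eval_trm A h t = zero"
  shows null
  unfolding null_def
proof (intro ballI)
  fix a b assume ab: "a \<in> carr A" "b \<in> carr A"
  obtain c where c: "proper_colouring (quad t) c" using colouring_of_nondegenerate[OF t] .
  define h where "h z = (if z = x then zero
    else if z \<in> Field (quad t) then if c z then a else b else mul_op A a b)" for z
  have h: "range h \<subseteq> carr A" "h x = zero" using ab by (auto simp: h_def)
  show "mul_op A a b = zero"
    by (rule mul_zero_of_coloured_eval[OF h(1) _ c ab _ _ zero[OF h]])
      (use t x in \<open>auto simp: degenerate_def h_def\<close>)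
qed

lemma null_of_degenerate:
  assumes "satisfies A (s, t)" "degenerate s" "\<not> degenerate t"
  shows null
proof (rule null_of_zero_term[OF assms(3)])
  fix h :: "nat \<Rightarrow> 'a" assume "range h \<subseteq> carr A"
  then show "eval_trm A h t = zero"
    using assms(1) degenerate_zero[OF _ assms(2)] by (metis fst_conv satisfies_def snd_conv)
qed

text \<open>
  If the extra variable \<open>x\<close> is a vertex of \<open>t\<close>, then \<open>t = s + t\<close> contains \<open>x\<close> together with a
  product \<open>xy\<close> and vanishes identically. Otherwise \<open>x\<close> does not occur in \<open>t\<close> at all and can be
  made zero without affecting \<open>t\<close>.
\<close>

lemma null_of_linear_word:
  assumes st: "satisfies A (s, t)" and t: "\<not> degenerate t" and x: "x \<in> lin s" "x \<notin> lin t"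
  shows null
proof (cases "x \<in> Field (quad t)")
  case True
  have "eval_trm A h t = zero" if h: "range h \<subseteq> carr A" for h
  proof -
    have "eval_trm A h s = eval_trm A h t" using st h by (simp add: satisfies_def)
    then have "eval_trm A h t = eval_trm A h (Plus s t)" using h by (simp add: add_idem)
    also have "degenerate (Plus s t)" using x True by (auto simp: degenerate_def Field_def)
    then have "eval_trm A h (Plus s t) = zero" by (rule degenerate_zero[OF h])
    finally show ?thesis .
  qed
  then show ?thesis by (rule null_of_zero_term[OF t])
next
  case False
  show ?thesis
  proof (rule null_of_vanishing_variable[OF t False x(2)])
    fix h :: "nat \<Rightarrow> 'a" assume h: "range h \<subseteq> carr A" and "h x = zero"
    then have "eval_trm A h s = zero" using word_le_eval(1)[OF h x(1)] by simp
    then show "eval_trm A h t = zero" using st h by (simp add: satisfies_def)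
  qed
qed

text \<open>
  If \<open>x\<close> or \<open>y\<close> does not occur in \<open>t\<close>, making it zero kills only \<open>s\<close>. Otherwise, since no odd
  walk of \<open>t\<close> joins \<open>x\<close> and \<open>y\<close>, there is a colouring giving them the same colour. Collapsing
  \<open>t\<close> along it to \<open>ab\<close> turns the edge \<open>xy\<close> of \<open>s\<close> into a square.
\<close>

lemma null_of_quadratic_word:
  assumes st: "satisfies A (s, t)" and s: "\<not> degenerate s" and t: "\<not> degenerate t"
    and lin: "lin s = lin t" and xy: "(x, y) \<in> quad s" "\<not> odd_walk (quad t) x y"
  shows null
proof -
  have vanish: "eval_trm A h t = zero" if h: "range h \<subseteq> carr A" and "mul_op A (h x) (h y) = zero" for h
  proof -
    have "eval_trm A h s = zero" using word_le_eval(2)[OF h xy(1)] that by simp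
    then show ?thesis using st h by (simp add: satisfies_def)
  qed
  have not_lin: "x \<notin> lin t" "y \<notin> lin t"
    using s xy(1) lin by (auto simp: degenerate_def Field_def)
  have zero: "mul_op A (h x) (h y) = zero" if "range h \<subseteq> carr A" "h x = zero \<or> h y = zero" for h :: "nat \<Rightarrow> 'a"
    using that(2)
  proof
    assume "h x = zero" then show ?thesis using that(1) by (simp add: image_subset_iff)
  next
    assume "h y = zero" then show ?thesis using that(1) by (simp add: image_subset_iff)
  qed
  consider "x \<notin> Field (quad t)" | "y \<notin> Field (quad t)" | "x \<in> Field (quad t)" "y \<in> Field (quad t)"
    by blast
  then show ?thesis
  proof cases
    case 1
    then show ?thesis
      by (rule null_of_vanishing_variable[OF t _ not_lin(1)]) (rule vanish, assumption, rule zero, simp_all)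
  next
    case 2
    then show ?thesis
      by (rule null_of_vanishing_variable[OF t _ not_lin(2)]) (rule vanish, assumption, rule zero, simp_all)
  next
    case 3
    show ?thesis
      unfolding null_def
    proof (intro ballI)
      fix a b assume ab: "a \<in> carr A" "b \<in> carr A"
      obtain c where c: "proper_colouring (quad t) c" "c x = c y"
        using proper_colouring_equal_at[OF _ xy(2)] t by (auto simp: degenerate_def)
      define h where "h z = (if z \<in> Field (quad t) then if c z then a else b else mul_op A a b)" for z
      have h: "range h \<subseteq> carr A" using ab by (auto simp: h_def)
      have "mul_op A (h x) (h y) = zero" using 3 c(2) ab by (simp add: h_def square)
      then show "mul_op A a b = zero"
        by (intro mul_zero_of_coloured_eval[OF h _ c(1) ab _ _ vanish[OF h]])
          (use t in \<open>auto simp: degenerate_def h_def\<close>)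
    qed
  qed
qed

lemma null_path_law:
  assumes null
  shows path_law
  unfolding path_law_def
proof (intro ballI impI)
  fix a b c d e assume "a \<in> carr A" "b \<in> carr A" "d \<in> carr A" "mul_op A a b \<preceq> e"
  moreover have "mul_op A a d = zero" "mul_op A a b = zero"
    using assms calculation(1-3) unfolding null_def by blast+
  ultimately show "mul_op A a d \<preceq> e" by argo
qed

text \<open>
  The remaining case: \<open>x\<close> and \<open>y\<close> lie on opposite sides of one component of \<open>t\<close> but are not
  adjacent. Send \<open>x\<close> to \<open>a\<close>, \<open>y\<close> to \<open>d\<close>, the other vertices coloured like \<open>x\<close> to \<open>c\<close>, and
  those coloured like \<open>y\<close> to \<open>b\<close>. Then every edge of \<open>t\<close> becomes \<open>ab\<close>, \<open>bc\<close> or \<open>cd\<close>, while \<open>s\<close>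
  contains \<open>ad\<close>.
\<close>

lemma path_law_of_quadratic_word:
  assumes st: "satisfies A (s, t)" and s: "\<not> degenerate s" and t: "\<not> degenerate t"
    and lin: "lin s = lin t" and xy: "(x, y) \<in> quad s" "(x, y) \<notin> quad t \<union> (quad t)\<inverse>"
  shows path_law
proof (cases "odd_walk (quad t) x y")
  case False
  then show ?thesis using null_of_quadratic_word[OF st s t lin xy(1)] null_path_law by blast
next
  case True
  obtain col where col: "proper_colouring (quad t) col" using colouring_of_nondegenerate[OF t] .
  have cxy: "col x \<noteq> col y" using odd_walk_colours[OF True col] .
  show ?thesis
    unfolding path_law_def
  proof (intro ballI impI)
    fix a b c d e assume abcde: "a \<in> carr A" "b \<in> carr A" "c \<in> carr A" "d \<in> carr A" "e \<in> carr A"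
      and le: "mul_op A a b \<preceq> e" "mul_op A b c \<preceq> e" "mul_op A c d \<preceq> e"
    define h where "h z = (if z = x then a else if z = y then d else if z \<in> Field (quad t)
      then if col z = col x then c else b else e)" for z
    have h: "range h \<subseteq> carr A" using abcde by (auto simp: h_def)
    have hx: "h z \<in> carr A" for z using h by auto
    have edge: "mul_op A (h u) (h v) \<preceq> e"
      if "col u = col x" "col v \<noteq> col x" "(u, v) \<in> quad t \<union> (quad t)\<inverse>" for u v
    proof -
      have "u \<in> Field (quad t)" "v \<in> Field (quad t)" "u \<noteq> x \<or> v \<noteq> y"
        using that(3) xy(2) by (auto simp: Field_def)
      moreover have "u \<noteq> y" "v \<noteq> x" using that(1,2) cxy by blast+
      ultimately have "h u = (if u = x then a else c)" "h v = (if v = y then d else b)" "u \<noteq> x \<or> v \<noteq> y"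
        using that(1,2) by (simp_all add: h_def)
      then have "h u = a \<and> h v = b \<or> h u = c \<and> h v = d \<or> h u = c \<and> h v = b" by presburger
      moreover have "mul_op A c b \<preceq> e" using le(2) mul_comm[OF abcde(3,2)] by argo
      ultimately show ?thesis using le(1,3) by metis
    qed
    have "mul_op A (h u) (h v) \<preceq> e" if "(u, v) \<in> quad t" for u v
    proof -
      have "col u \<noteq> col v" using that col by (auto simp: proper_colouring_def)
      then consider "col u = col x" "col v \<noteq> col x" | "col v = col x" "col u \<noteq> col x" by blast
      then show ?thesis
      proof cases
        case 1
        then show ?thesis by (rule edge) (use that in simp)
      next
        case 2
        then have "mul_op A (h v) (h u) \<preceq> e" by (rule edge) (use that in simp)
        then show ?thesis using mul_comm[OF hx[of u] hx[of v]] by argo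
      qed
    qed
    moreover have "h z = e" if "z \<in> lin t" for z
      using that t odd_walk_Field[OF True] by (auto simp: degenerate_def h_def)
    ultimately have "eval_trm A h t \<preceq> e"
      using t abcde unfolding eval_le[OF h abcde(5)] degenerate_def by auto
    moreover have "eval_trm A h s = eval_trm A h t" using st h by (simp add: satisfies_def)
    ultimately have "mul_op A (h x) (h y) \<preceq> e"
      using xy(1) eval_le[OF h abcde(5), of s] by force
    moreover have "h x = a" "h y = d" using cxy by (auto simp: h_def)
    ultimately show "mul_op A a d \<preceq> e" by argo
  qed
qed

end


section \<open>Three equivalences of terms\<close>

text \<open>
  The equational theories of the three nontrivial subvarieties: of the whole variety, of the
  one with the path law, where only the components of the graph and their sides matter, and of
  the one with zero multiplication, where any word of length at least two makes the term zero.
\<close>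

definition same_normal_form :: "trm \<Rightarrow> trm \<Rightarrow> bool" where
  "same_normal_form s t \<longleftrightarrow> (degenerate s \<and> degenerate t) \<or> (\<not> degenerate s \<and> \<not> degenerate t \<and>
     lin s = lin t \<and> quad s \<union> (quad s)\<inverse> = quad t \<union> (quad t)\<inverse>)"

definition same_components :: "trm \<Rightarrow> trm \<Rightarrow> bool" where
  "same_components s t \<longleftrightarrow> (degenerate s \<and> degenerate t) \<or> (\<not> degenerate s \<and> \<not> degenerate t \<and>
     lin s = lin t \<and> (\<forall>(x, y)\<in>quad s. odd_walk (quad t) x y) \<and> (\<forall>(x, y)\<in>quad t. odd_walk (quad s) x y))"

definition same_linear_part :: "trm \<Rightarrow> trm \<Rightarrow> bool" where
  "same_linear_part s t \<longleftrightarrow> (big s \<or> quad s \<noteq> {} \<longleftrightarrow> big t \<or> quad t \<noteq> {}) \<and>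
     (big s \<or> quad s \<noteq> {} \<or> lin s = lin t)"

lemma satisfies_sym: "satisfies A (s, t) \<Longrightarrow> satisfies A (t, s)"
  by (simp add: satisfies_def)

context bipartite_semiring
begin

lemma satisfies_same_normal_form:
  assumes "same_normal_form s t"
  shows "satisfies A (s, t)"
proof -
  have "eval_trm A h s = eval_trm A h t" if h: "range h \<subseteq> carr A" for h
    using assms unfolding same_normal_form_def
  proof (elim disjE conjE)
    assume "degenerate s" "degenerate t"
    then show ?thesis using degenerate_zero[OF h] by metis
  next
    assume "lin s = lin t" "quad s \<union> (quad s)\<inverse> = quad t \<union> (quad t)\<inverse>"
      and "\<not> degenerate s" "\<not> degenerate t"
    then show ?thesis by (intro eval_lin_quad_cong[OF h]) (simp_all add: degenerate_def)
  qed
  then show ?thesis by (simp add: satisfies_def)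
qed

lemma null_or_same_components:
  assumes st: "satisfies A (s, t)"
  shows "null \<or> same_components s t"
proof (rule disjCI)
  assume "\<not> same_components s t"
  then consider "degenerate s \<noteq> degenerate t"
    | "\<not> degenerate s" "\<not> degenerate t" "lin s \<noteq> lin t"
    | x y where "\<not> degenerate s" "\<not> degenerate t" "lin s = lin t" "(x, y) \<in> quad s" "\<not> odd_walk (quad t) x y"
    | x y where "\<not> degenerate s" "\<not> degenerate t" "lin s = lin t" "(x, y) \<in> quad t" "\<not> odd_walk (quad s) x y"
    unfolding same_components_def by blast
  then show null
  proof cases
    case 1
    then show ?thesis using null_of_degenerate[OF st] null_of_degenerate[OF satisfies_sym[OF st]] by blast
  next
    case 2
    then show ?thesis
      using null_of_linear_word[OF st] null_of_linear_word[OF satisfies_sym[OF st]] by blast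
  next
    case 3
    then show ?thesis using null_of_quadratic_word[OF st] by blast
  next
    case 4
    then show ?thesis using null_of_quadratic_word[OF satisfies_sym[OF st]] by metis
  qed
qed

lemma path_law_or_same_normal_form:
  assumes st: "satisfies A (s, t)"
  shows "path_law \<or> same_normal_form s t"
proof (rule disjCI)
  assume not_same: "\<not> same_normal_form s t"
  show path_law
  proof (cases "same_components s t")
    case False
    then show ?thesis using null_or_same_components[OF st] null_path_law by blast
  next
    case True
    with not_same have nd: "\<not> degenerate s" "\<not> degenerate t" "lin s = lin t"
      and "quad s \<union> (quad s)\<inverse> \<noteq> quad t \<union> (quad t)\<inverse>"
      unfolding same_components_def same_normal_form_def by blast+
    then consider x y where "(x, y) \<in> quad s" "(x, y) \<notin> quad t \<union> (quad t)\<inverse>"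
      | x y where "(x, y) \<in> quad t" "(x, y) \<notin> quad s \<union> (quad s)\<inverse>"
      by auto
    then show ?thesis
    proof cases
      case 1
      then show ?thesis by (rule path_law_of_quadratic_word[OF st nd])
    next
      case 2
      then show ?thesis
        by (rule path_law_of_quadratic_word[OF satisfies_sym[OF st] nd(2,1) nd(3)[symmetric]])
    qed
  qed
qed

end

context nil_semiring
begin

lemma satisfies_same_components:
  assumes path_law "same_components s t"
  shows "satisfies A (s, t)"
  unfolding satisfies_def
proof (intro allI impI)
  fix h :: "nat \<Rightarrow> 'a" assume h: "range h \<subseteq> carr A"
  show "eval_trm A h (fst (s, t)) = eval_trm A h (snd (s, t))"
  proof (cases "degenerate s")
    case True
    then have "degenerate t" using assms(2) unfolding same_components_def by blast
    then show ?thesis using True path_law_degenerate[OF assms(1) h] by simp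
  next
    case False
    then have "\<not> big s" "\<not> big t" "lin s = lin t"
      and "\<And>x y. (x, y) \<in> quad s \<Longrightarrow> odd_walk (quad t) x y"
      and "\<And>x y. (x, y) \<in> quad t \<Longrightarrow> odd_walk (quad s) x y"
      using assms(2) unfolding same_components_def degenerate_def by blast+
    from path_law_eval_eq[OF assms(1) h this] show ?thesis by simp
  qed
qed

lemma satisfies_same_linear_part:
  assumes null "same_linear_part s t"
  shows "satisfies A (s, t)"
proof -
  have "eval_trm A h s = eval_trm A h t" if "range h \<subseteq> carr A" for h
    using null_eval_eq[OF assms(1) that] assms(2) unfolding same_linear_part_def by blast
  then show ?thesis by (simp add: satisfies_def)
qed

text \<open>
  Assigning one element \<open>a\<close> to all variables gives \<open>a\<close> for a linear term and zero for any
  other. For two linear terms with different variables, making a variable of only one of them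
  zero again yields \<open>a = 0\<close>.
\<close>

lemma trivial_or_same_linear_part:
  assumes st: "satisfies A (s, t)"
  shows "carr A = {zero} \<or> same_linear_part s t"
proof (rule disjCI)
  assume not_same: "\<not> same_linear_part s t"
  have eval_s: "eval_trm A h s = eval_trm A h t" if "range h \<subseteq> carr A" for h
    using st that by (simp add: satisfies_def)
  have const: "eval_trm A (\<lambda>_. a) u = (if big u \<or> quad u \<noteq> {} then zero else a)" if a: "a \<in> carr A" for a u
  proof (rule eq_iff_upper)
    fix c assume c: "c \<in> carr A"
    have "(\<forall>(x, y)\<in>quad u. zero \<preceq> c) \<longleftrightarrow> quad u = {} \<or> c = zero" using c by auto
    then show "eval_trm A (\<lambda>_. a) u \<preceq> c \<longleftrightarrow> (if big u \<or> quad u \<noteq> {} then zero else a) \<preceq> c"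
      using a c term_has_word[of u] by (auto simp: eval_le square)
  qed (use a in auto)
  have "a = zero" if a: "a \<in> carr A" for a
  proof (cases "big s \<or> quad s \<noteq> {} \<longleftrightarrow> big t \<or> quad t \<noteq> {}")
    case False
    have "eval_trm A (\<lambda>_. a) s = eval_trm A (\<lambda>_. a) t" by (rule eval_s) (use a in auto)
    then show ?thesis using False unfolding const[OF a] by presburger
  next
    case True
    with not_same have words: "\<not> big s" "quad s = {}" "\<not> big t" "quad t = {}" "lin s \<noteq> lin t"
      by (auto simp: same_linear_part_def)
    have "a = zero" if "x \<in> lin u" "x \<notin> lin v" "eval_trm A (\<lambda>z. if z = x then zero else a) u =
      eval_trm A (\<lambda>z. if z = x then zero else a) v" "\<not> big v" "quad v = {}" for x u v
    proof -
      let ?h = "\<lambda>z. if z = x then zero else a"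
      have h: "range ?h \<subseteq> carr A" using a by auto
      have "eval_trm A ?h v \<preceq> a" using that(2,4,5) a by (auto simp: eval_le[OF h a])
      moreover have "eval_trm A ?h v = zero" using word_le_eval(1)[OF h that(1)] h that(3) by simp
      ultimately show ?thesis using a by simp
    qed
    note * = this
    obtain x where "x \<in> lin s \<and> x \<notin> lin t \<or> x \<in> lin t \<and> x \<notin> lin s" using words(5) by blast
    moreover have "range (\<lambda>z. if z = x then zero else a) \<subseteq> carr A" using a by auto
    note eval_s[OF this]
    ultimately show ?thesis using *[of x s t] *[of x t s] words by metis
  qed
  then show "carr A = {zero}" using zero_closed by blast
qed

end


section \<open>Finite bases\<close>

text \<open>
  The absorbing element is named in identities by the cube of a further variable.
\<close>

definition zero_trm :: "nat \<Rightarrow> trm" where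
  "zero_trm n = Times (Var n) (Times (Var n) (Var n))"

definition nil_basis :: "(trm \<times> trm) set" where
  "nil_basis = {
    (Plus (Var 0) (Var 0), Var 0),
    (Plus (Var 0) (Var 1), Plus (Var 1) (Var 0)),
    (Plus (Plus (Var 0) (Var 1)) (Var 2), Plus (Var 0) (Plus (Var 1) (Var 2))),
    (Times (Var 0) (Var 1), Times (Var 1) (Var 0)),
    (Times (Var 0) (Plus (Var 1) (Var 2)), Plus (Times (Var 0) (Var 1)) (Times (Var 0) (Var 2))),
    (Times (Var 0) (Times (Var 1) (Var 2)), zero_trm 3),
    (Plus (Var 0) (zero_trm 1), zero_trm 1),
    (Times (Var 0) (Var 0), zero_trm 1),
    (Plus (Var 0) (Times (Var 0) (Var 1)), zero_trm 2)}"

definition path_trm :: trm where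
  "path_trm = Plus (Plus (Times (Var 0) (Var 1)) (Times (Var 1) (Var 2))) (Times (Var 2) (Var 3))"

definition path_identity :: "trm \<times> trm" where
  "path_identity = (Plus (Times (Var 0) (Var 3)) path_trm, path_trm)"

definition null_identity :: "trm \<times> trm" where
  "null_identity = (Times (Var 0) (Var 1), zero_trm 2)"

definition trivial_identity :: "trm \<times> trm" where
  "trivial_identity = (Var 0, Var 1)"

definition assign :: "'a \<Rightarrow> 'a \<Rightarrow> 'a \<Rightarrow> 'a \<Rightarrow> nat \<Rightarrow> 'a" where
  "assign a b c d n = (if n = 0 then a else if n = 1 then b else if n = 2 then c else d)"

lemma assign_simps [simp]:
  "assign a b c d 0 = a" "assign a b c d (Suc 0) = b" "assign a b c d 2 = c" "assign a b c d 3 = d"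
  by (simp_all add: assign_def)

lemma satisfies_assign:
  assumes "satisfies A (s, t)" "a \<in> carr A" "b \<in> carr A" "c \<in> carr A" "d \<in> carr A"
  shows "eval_trm A (assign a b c d) s = eval_trm A (assign a b c d) t"
proof -
  have "range (assign a b c d) \<subseteq> carr A" using assms by (auto simp: assign_def)
  then show ?thesis using assms(1) by (simp add: satisfies_def)
qed

lemma nil_semiring_of_basis:
  assumes "A \<in> models nil_basis"
  obtains z where "nil_semiring A z"
proof -
  have alg: "is_algebra A" and sat: "\<And>e. e \<in> nil_basis \<Longrightarrow> satisfies A e"
    using assms by (auto simp: models_def)
  obtain o0 where o: "o0 \<in> carr A" using alg by (auto simp: is_algebra_def)
  define z where "z = mul_op A o0 (mul_op A o0 o0)"
  have eqs: "eval_trm A (assign a b c o0) s = eval_trm A (assign a b c o0) t"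
    if "(s, t) \<in> nil_basis" "a \<in> carr A" "b \<in> carr A" "c \<in> carr A" for s t a b c
    using satisfies_assign[OF sat[OF that(1)] that(2-4) o] .
  have "nil_semiring A z"
  proof
    fix a b c assume abc: "a \<in> carr A" "b \<in> carr A" "c \<in> carr A"
    show "add_op A (add_op A a b) c = add_op A a (add_op A b c)"
      using eqs[of "Plus (Plus (Var 0) (Var 1)) (Var 2)" "Plus (Var 0) (Plus (Var 1) (Var 2))", OF _ abc]
      by (simp add: nil_basis_def)
    show "mul_op A a (add_op A b c) = add_op A (mul_op A a b) (mul_op A a c)"
      using eqs[of "Times (Var 0) (Plus (Var 1) (Var 2))"
          "Plus (Times (Var 0) (Var 1)) (Times (Var 0) (Var 2))", OF _ abc]
      by (simp add: nil_basis_def)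
    show "mul_op A a (mul_op A b c) = z"
      using eqs[of "Times (Var 0) (Times (Var 1) (Var 2))" "zero_trm 3", OF _ abc]
      by (simp add: nil_basis_def zero_trm_def z_def)
  next
    fix a b assume ab: "a \<in> carr A" "b \<in> carr A"
    show "add_op A a b = add_op A b a"
      using eqs[of "Plus (Var 0) (Var 1)" "Plus (Var 1) (Var 0)", OF _ ab o] by (simp add: nil_basis_def)
    show "mul_op A a b = mul_op A b a"
      using eqs[of "Times (Var 0) (Var 1)" "Times (Var 1) (Var 0)", OF _ ab o] by (simp add: nil_basis_def)
    show "add_op A a (mul_op A a b) = z"
      using eqs[of "Plus (Var 0) (Times (Var 0) (Var 1))" "zero_trm 2", OF _ ab o]
      by (simp add: nil_basis_def zero_trm_def z_def)
  next
    fix a assume a: "a \<in> carr A"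
    show "add_op A a a = a"
      using eqs[of "Plus (Var 0) (Var 0)" "Var 0", OF _ a o o] by (simp add: nil_basis_def)
    show "add_op A a z = z"
      using eqs[of "Plus (Var 0) (zero_trm 1)" "zero_trm 1", OF _ a o o]
      by (simp add: nil_basis_def zero_trm_def z_def)
    show "mul_op A a a = z"
      using eqs[of "Times (Var 0) (Var 0)" "zero_trm 1", OF _ a o o]
      by (simp add: nil_basis_def zero_trm_def z_def)
  qed (rule alg)
  then show ?thesis by (rule that)
qed

context nil_semiring
begin

lemma models_nil_basis: "A \<in> models nil_basis"
proof -
  have zero_trm: "eval_trm A h (zero_trm n) = zero" if "h n \<in> carr A" for h n
    using that by (simp add: zero_trm_def cube)
  have "\<forall>e\<in>nil_basis. eval_trm A h (fst e) = eval_trm A h (snd e)" if "range h \<subseteq> carr A" for h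
  proof -
    have h: "h n \<in> carr A" for n using that by auto
    show ?thesis
      unfolding nil_basis_def ball_simps fst_conv snd_conv eval_trm.simps zero_trm[OF h]
      by (intro conjI TrueI add_idem add_comm add_assoc mul_comm distrib cube add_zero square add_mul h)
  qed
  then have "\<forall>e\<in>nil_basis. satisfies A e" by (simp add: satisfies_def)
  then show ?thesis using alg by (simp add: models_def)
qed

lemma satisfies_path_identity: "satisfies A path_identity \<longleftrightarrow> path_law"
proof
  assume sat: "satisfies A path_identity"
  show path_law
    unfolding path_law_def
  proof (intro ballI impI)
    fix a b c d e assume abcd: "a \<in> carr A" "b \<in> carr A" "c \<in> carr A" "d \<in> carr A" and e: "e \<in> carr A"
      and le: "mul_op A a b \<preceq> e" "mul_op A b c \<preceq> e" "mul_op A c d \<preceq> e"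
    let ?p = "add_op A (add_op A (mul_op A a b) (mul_op A b c)) (mul_op A c d)"
    have "mul_op A a d \<preceq> ?p"
      using satisfies_assign[OF sat[unfolded path_identity_def] abcd]
      by (simp add: path_trm_def le_def)
    moreover have "?p \<preceq> e" using le abcd e by (simp add: add_le)
    ultimately show "mul_op A a d \<preceq> e" using le_trans[of "mul_op A a d" ?p e] abcd e by simp
  qed
next
  assume path_law
  show "satisfies A path_identity"
    unfolding satisfies_def
  proof (intro allI impI)
    fix h :: "nat \<Rightarrow> 'a" assume h: "range h \<subseteq> carr A"
    let ?p = "eval_trm A h path_trm"
    have "?p \<preceq> ?p" using h by simp
    then have "mul_op A (h 0) (h 1) \<preceq> ?p" "mul_op A (h 1) (h 2) \<preceq> ?p" "mul_op A (h 2) (h 3) \<preceq> ?p"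
      using eval_le[OF h eval_in_carr[OF h], of path_trm path_trm] by (simp_all add: path_trm_def)
    moreover have "h n \<in> carr A" "?p \<in> carr A" for n using h by auto
    ultimately have "mul_op A (h 0) (h 3) \<preceq> ?p"
      using \<open>path_law\<close> unfolding path_law_def by blast
    then show "eval_trm A h (fst path_identity) = eval_trm A h (snd path_identity)"
      by (simp add: path_identity_def le_def)
  qed
qed

lemma satisfies_null_identity: "satisfies A null_identity \<longleftrightarrow> null"
proof
  assume sat: "satisfies A null_identity"
  show null
    unfolding null_def
  proof (intro ballI)
    fix a b assume ab: "a \<in> carr A" "b \<in> carr A"
    show "mul_op A a b = zero"
      using satisfies_assign[OF sat[unfolded null_identity_def] ab zero_closed zero_closed]
      by (simp add: zero_trm_def)
  qed
next
  assume null
  have "eval_trm A h (Times (Var 0) (Var 1)) = eval_trm A h (zero_trm 2)" if "range h \<subseteq> carr A" for h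
  proof -
    have "h n \<in> carr A" for n using that by auto
    then show ?thesis using \<open>null\<close> unfolding null_def by (simp add: zero_trm_def)
  qed
  then show "satisfies A null_identity" by (simp add: satisfies_def null_identity_def)
qed

end


section \<open>The semiring SR6\<close>

interpretation SR6: nil_semiring SR6 1
proof
  have comm: "\<forall>a\<in>carr SR6. \<forall>b\<in>carr SR6. mul_op SR6 a b = mul_op SR6 b a"
    by (simp add: SR6_def sr6_mul_def)
  have cube: "\<forall>a\<in>carr SR6. \<forall>b\<in>carr SR6. \<forall>c\<in>carr SR6. mul_op SR6 a (mul_op SR6 b c) = 1"
    by (simp add: SR6_def sr6_mul_def)
  have zero: "\<forall>a\<in>carr SR6. add_op SR6 a 1 = 1 \<and> mul_op SR6 a a = 1"
    by (simp add: SR6_def sr6_add_def sr6_mul_def)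
  have add_mul: "\<forall>a\<in>carr SR6. \<forall>b\<in>carr SR6. add_op SR6 a (mul_op SR6 a b) = 1"
    by (simp add: SR6_def sr6_add_def sr6_mul_def)
  note ai = is_ai_semiring_SR6[unfolded is_ai_semiring_def]
  show "is_algebra SR6" using ai by blast
  fix a assume a: "a \<in> carr SR6"
  show "add_op SR6 a a = a" using ai a by blast
  show "add_op SR6 a 1 = 1" "mul_op SR6 a a = 1" using zero a by blast+
  fix b assume b: "b \<in> carr SR6"
  show "add_op SR6 a b = add_op SR6 b a" using ai a b by blast
  show "mul_op SR6 a b = mul_op SR6 b a" using comm a b by blast
  show "add_op SR6 a (mul_op SR6 a b) = 1" using add_mul a b by blast
  fix c assume c: "c \<in> carr SR6"
  show "add_op SR6 (add_op SR6 a b) c = add_op SR6 a (add_op SR6 b c)" using ai a b c by blast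
  show "mul_op SR6 a (add_op SR6 b c) = add_op SR6 (mul_op SR6 a b) (mul_op SR6 a c)"
    using ai a b c by blast
  show "mul_op SR6 a (mul_op SR6 b c) = 1" using cube a b c by blast
qed

interpretation SR6: bipartite_semiring SR6 1
proof
  fix h :: "nat \<Rightarrow> nat" and t assume h: "range h \<subseteq> carr SR6" and t: "degenerate t"
  let ?e = "eval_trm SR6 h t"
  show "?e = 1"
  proof (rule ccontr)
    assume ne: "?e \<noteq> 1"
    then obtain x where x: "odd_walk (quad t) x x"
      using t SR6.word_le_eval(3)[OF h] SR6.lin_meets_quad_zero[OF h] unfolding degenerate_def by blast
    have "(h u \<in> {2, 5}) \<noteq> (h v \<in> {2, 5})" if "(u, v) \<in> quad t" for u v
    proof -
      have "SR6.le (mul_op SR6 (h u) (h v)) ?e" using SR6.word_le_eval(2)[OF h that] .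
      then have "mul_op SR6 (h u) (h v) \<noteq> 1"
        using ne SR6.zero_le[OF SR6.eval_in_carr[OF h, of t]] by metis
      then show ?thesis by (auto simp: SR6_def sr6_mul_def split: if_splits)
    qed
    then have "proper_colouring (quad t) (\<lambda>u. h u \<in> {2, 5})"
      unfolding proper_colouring_def by blast
    then show False using odd_walk_colours[OF x] by blast
  qed
qed

text \<open>
  The pairs with product \<open>3\<close> form the path \<open>2 - 6 - 5 - 4\<close>, whose ends multiply to \<open>1\<close>.
\<close>

lemma not_path_law_SR6: "\<not> SR6.path_law"
proof
  assume "SR6.path_law"
  note law = this[unfolded SR6.path_law_def, rule_format, of 2 6 5 4 3]
  have "SR6.le (mul_op SR6 2 4) 3"
    by (rule law, unfold SR6.le_def) (simp_all add: SR6_def sr6_add_def sr6_mul_def)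
  then show False unfolding SR6.le_def by (simp add: SR6_def sr6_add_def sr6_mul_def)
qed

lemma satisfies_SR6: "satisfies SR6 (s, t) \<longleftrightarrow> same_normal_form s t"
  using SR6.satisfies_same_normal_form[of s t] SR6.path_law_or_same_normal_form[of s t]
    not_path_law_SR6 by argo

text \<open>
  The cube of any term contains a long word, so this identity says that \<open>t\<close> is zero. Through
  it the vanishing of all odd cycles passes from SR6 to the algebras satisfying its
  identities.
\<close>

lemma degenerate_cube:
  assumes "degenerate t"
  shows "satisfies SR6 (t, Times t (Times t t))"
proof -
  have "big (Times t (Times t t))" using term_has_word[of t] by auto
  then show ?thesis using assms by (simp add: satisfies_SR6 same_normal_form_def degenerate_def)
qed

lemma bipartite_semiring_of_SR6:
  assumes "is_algebra A" and sat: "\<And>e. satisfies SR6 e \<Longrightarrow> satisfies A e"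
  obtains z where "bipartite_semiring A z"
proof -
  have "A \<in> models nil_basis"
    using SR6.models_nil_basis assms unfolding models_def by blast
  then obtain z where "nil_semiring A z" by (rule nil_semiring_of_basis)
  then interpret nil_semiring A z .
  have "bipartite_semiring A z"
  proof
    fix h :: "nat \<Rightarrow> 'a" and t assume h: "range h \<subseteq> carr A" and "degenerate t"
    then have "satisfies A (t, Times t (Times t t))" by (intro sat degenerate_cube)
    then have "eval_trm A h t = eval_trm A h (Times t (Times t t))" using h by (simp add: satisfies_def)
    also have "\<dots> = z" using h by (simp add: cube)
    finally show "eval_trm A h t = z" .
  qed
  then show ?thesis by (rule that)
qed


section \<open>Semirings of vertex sets of a graph\<close>

text \<open>
  An analogue of SR6 for an arbitrary graph: sets of vertices are added by union, and two sets
  multiply to \<open>Edge\<close> iff they are completely joined. Sets instead of single vertices are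
  forced by distributivity. The role of \<open>1\<close> and \<open>3\<close> is played by \<open>Top\<close> and \<open>Edge\<close>.
\<close>

datatype 'v graph_elt = Vertices "'v set" | Edge | Top

fun graph_add :: "'v graph_elt \<Rightarrow> 'v graph_elt \<Rightarrow> 'v graph_elt" where
  "graph_add (Vertices X) (Vertices Y) = Vertices (X \<union> Y)"
| "graph_add Edge Edge = Edge"
| "graph_add _ _ = Top"

fun graph_mul :: "('v \<times> 'v) set \<Rightarrow> 'v graph_elt \<Rightarrow> 'v graph_elt \<Rightarrow> 'v graph_elt" where
  "graph_mul E (Vertices X) (Vertices Y) = (if X \<times> Y \<subseteq> E then Edge else Top)"
| "graph_mul E _ _ = Top"

definition graph_semiring :: "'v set \<Rightarrow> ('v \<times> 'v) set \<Rightarrow> 'v graph_elt algebra" where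
  "graph_semiring V E = \<lparr>carr = insert Edge (insert Top (Vertices ` (Pow V - {{}}))),
     add_op = graph_add, mul_op = graph_mul E\<rparr>"

lemma nil_semiring_graph:
  assumes "sym E" "irrefl E"
  shows "nil_semiring (graph_semiring V E) Top"
proof
  show "is_algebra (graph_semiring V E)"
    by (auto simp: graph_semiring_def is_algebra_def)
next
  fix a b c assume "a \<in> carr (graph_semiring V E)" "b \<in> carr (graph_semiring V E)" "c \<in> carr (graph_semiring V E)"
  show "add_op (graph_semiring V E) (add_op (graph_semiring V E) a b) c =
      add_op (graph_semiring V E) a (add_op (graph_semiring V E) b c)"
    by (cases a; cases b; cases c) (simp_all add: graph_semiring_def Un_assoc)
  show "mul_op (graph_semiring V E) a (add_op (graph_semiring V E) b c) =
      add_op (graph_semiring V E) (mul_op (graph_semiring V E) a b) (mul_op (graph_semiring V E) a c)"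
    by (cases a; cases b; cases c) (auto simp: graph_semiring_def)
  show "mul_op (graph_semiring V E) a (mul_op (graph_semiring V E) b c) = Top"
    by (cases a; cases b; cases c) (auto simp: graph_semiring_def)
next
  fix a b assume ab: "a \<in> carr (graph_semiring V E)" "b \<in> carr (graph_semiring V E)"
  show "add_op (graph_semiring V E) a b = add_op (graph_semiring V E) b a"
    by (cases a; cases b) (simp_all add: graph_semiring_def Un_commute)
  have "X \<times> Y \<subseteq> E \<longleftrightarrow> Y \<times> X \<subseteq> E" for X Y using assms(1) by (blast dest: symD)
  then show "mul_op (graph_semiring V E) a b = mul_op (graph_semiring V E) b a"
    by (cases a; cases b) (simp_all add: graph_semiring_def)
  show "add_op (graph_semiring V E) a (mul_op (graph_semiring V E) a b) = Top"
    by (cases a; cases b) (simp_all add: graph_semiring_def)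
next
  fix a assume a: "a \<in> carr (graph_semiring V E)"
  show "add_op (graph_semiring V E) a a = a" "add_op (graph_semiring V E) a Top = Top"
    by (cases a; simp add: graph_semiring_def)+
  show "mul_op (graph_semiring V E) a a = Top"
  proof (cases a)
    case (Vertices X)
    then have "X \<noteq> {}" using a by (auto simp: graph_semiring_def)
    then have "\<not> X \<times> X \<subseteq> E" using assms(2) by (auto simp: irrefl_def)
    then show ?thesis using Vertices by (simp add: graph_semiring_def)
  qed (simp_all add: graph_semiring_def)
qed

text \<open>
  A term that does not evaluate to \<open>Top\<close> is mapped edge by edge into \<open>E\<close> by picking a vertex
  from each set. If the image lies in a 2-colourable part of the graph, the colouring pulls
  back and the term has no closed odd walk.
\<close>

lemma graph_semiring_degenerate:
  assumes E: "sym E" "irrefl E"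
    and colour: "\<And>W. W \<subseteq> V \<Longrightarrow> finite W \<Longrightarrow> card W \<le> N \<Longrightarrow> \<exists>c. proper_colouring (E \<inter> W \<times> W) c"
    and h: "range h \<subseteq> carr (graph_semiring V E)"
    and t: "degenerate t" "card (Field (quad t)) \<le> N"
  shows "eval_trm (graph_semiring V E) h t = Top"
proof (rule ccontr)
  interpret nil_semiring "graph_semiring V E" Top by (rule nil_semiring_graph[OF E])
  let ?e = "eval_trm (graph_semiring V E) h t"
  assume ne: "?e \<noteq> Top"
  then obtain x where x: "odd_walk (quad t) x x"
    using t(1) word_le_eval(3)[OF h] lin_meets_quad_zero[OF h] unfolding degenerate_def by blast
  have edges: "\<exists>X Y. h u = Vertices X \<and> h v = Vertices Y \<and> X \<times> Y \<subseteq> E" if "(u, v) \<in> quad t" for u v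
  proof -
    have "le (mul_op (graph_semiring V E) (h u) (h v)) ?e" using word_le_eval(2)[OF h that] .
    then have "mul_op (graph_semiring V E) (h u) (h v) \<noteq> Top"
      using ne zero_le[OF eval_in_carr[OF h, of t]] by metis
    then show ?thesis
      by (cases "h u"; cases "h v") (auto simp: graph_semiring_def split: if_splits)
  qed
  define g where "g u = (SOME p. \<exists>X. h u = Vertices X \<and> p \<in> X)" for u
  have g: "g u \<in> X \<and> g u \<in> V" if "h u = Vertices X" for u X
  proof -
    have "h u \<in> carr (graph_semiring V E)" using h by auto
    then have "X \<noteq> {}" "X \<subseteq> V" using that by (auto simp: graph_semiring_def)
    then have "\<exists>p. \<exists>X. h u = Vertices X \<and> p \<in> X" using that by auto
    from someI_ex[OF this] show ?thesis using that \<open>X \<subseteq> V\<close> by (auto simp: g_def)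
  qed
  let ?W = "g ` Field (quad t)"
  have "finite (Field (quad t))" using finite_quad[of t] by (simp add: finite_Field)
  then have "finite ?W" "card ?W \<le> N" using card_image_le[of "Field (quad t)" g] t(2) by auto
  moreover have "?W \<subseteq> V" using edges g by (fastforce simp: Field_def)
  ultimately obtain c where c: "proper_colouring (E \<inter> ?W \<times> ?W) c" using colour by blast
  have "proper_colouring (quad t) (c \<circ> g)"
    unfolding proper_colouring_def
  proof (intro ballI, clarify)
    fix u v assume uv: "(u, v) \<in> quad t" and eq: "(c \<circ> g) u = (c \<circ> g) v"
    obtain X Y where "h u = Vertices X" "h v = Vertices Y" "X \<times> Y \<subseteq> E" using edges[OF uv] by blast
    then have "(g u, g v) \<in> E" using g by blast
    moreover have "g u \<in> ?W" "g v \<in> ?W" using uv by (auto simp: Field_def)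
    ultimately have "c (g u) \<noteq> c (g v)" using c by (auto simp: proper_colouring_def)
    then show False using eq by simp
  qed
  then show False using odd_walk_colours[OF x] by blast
qed


section \<open>Odd cycles\<close>

text \<open>
  The cycle of odd length \<open>2 n + 3\<close>.
\<close>

definition cycle_edges :: "nat \<Rightarrow> (nat \<times> nat) set" where
  "cycle_edges n = {(i, j). i \<le> 2 * n + 2 \<and> j \<le> 2 * n + 2 \<and>
     (j = Suc i \<or> i = Suc j \<or> i = 0 \<and> j = 2 * n + 2 \<or> i = 2 * n + 2 \<and> j = 0)}"

lemma sym_cycle_edges: "sym (cycle_edges n)"
  by (auto simp: sym_def cycle_edges_def)

lemma irrefl_cycle_edges: "irrefl (cycle_edges n)"
  by (auto simp: irrefl_def cycle_edges_def)

text \<open>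
  Any set of fewer vertices misses some \<open>p\<close>, and cutting the odd cycle at \<open>p\<close> leaves a path.
  Numbers alternate in parity along the cycle except between \<open>2 n + 2\<close> and \<open>0\<close>; switching the
  colours on one side of \<open>p\<close> repairs this edge and spoils only edges at \<open>p\<close>.
\<close>

lemma proper_colouring_cycle:
  assumes "finite W" "card W \<le> 2 * n + 2"
  shows "\<exists>c. proper_colouring (cycle_edges n \<inter> W \<times> W) c"
proof -
  have "\<not> {..2 * n + 2} \<subseteq> W"
  proof
    assume "{..2 * n + 2} \<subseteq> W"
    then have "card {..2 * n + 2} \<le> card W" using assms(1) by (rule card_mono[rotated])
    then show False using assms(2) by simp
  qed
  then obtain p where p: "p \<le> 2 * n + 2" "p \<notin> W" by auto
  have "((i < p) = even i) \<noteq> ((j < p) = even j)"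
    if "(i, j) \<in> cycle_edges n" and "i \<noteq> p" "j \<noteq> p" for i j
  proof -
    have "j = Suc i \<or> i = Suc j \<or> i = 0 \<and> j = 2 * n + 2 \<or> i = 2 * n + 2 \<and> j = 0"
      using that(1) by (simp add: cycle_edges_def)
    then show ?thesis
    proof (elim disjE conjE)
      assume "j = Suc i"
      then have "i < p \<longleftrightarrow> j < p" using that by linarith
      then show ?thesis using \<open>j = Suc i\<close> by simp
    next
      assume "i = Suc j"
      then have "i < p \<longleftrightarrow> j < p" using that by linarith
      then show ?thesis using \<open>i = Suc j\<close> by simp
    next
      assume "i = 0" "j = 2 * n + 2"
      moreover have "0 < p" "\<not> 2 * n + 2 < p" using calculation that p by auto
      ultimately show ?thesis by simp
    next
      assume "i = 2 * n + 2" "j = 0"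
      moreover have "0 < p" "\<not> 2 * n + 2 < p" using calculation that p by auto
      ultimately show ?thesis by simp
    qed
  qed
  then have "proper_colouring (cycle_edges n \<inter> W \<times> W) (\<lambda>i. (i < p) = even i)"
    using p(2) unfolding proper_colouring_def by blast
  then show ?thesis by blast
qed

primrec path_sum :: "nat \<Rightarrow> trm" where
  "path_sum 0 = Times (Var 0) (Var 1)"
| "path_sum (Suc n) = Plus (path_sum n) (Times (Var (Suc n)) (Var (Suc (Suc n))))"

definition cycle_sum :: "nat \<Rightarrow> trm" where
  "cycle_sum n = Plus (path_sum (2 * n + 1)) (Times (Var (2 * n + 2)) (Var 0))"

lemma path_sum_words: "lin (path_sum n) = {}" "\<not> big (path_sum n)"
  "quad (path_sum n) = {(i, Suc i) | i. i \<le> n}"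
  by (induction n) (auto simp: le_Suc_eq)

lemma cycle_sum_words: "lin (cycle_sum n) = {}" "\<not> big (cycle_sum n)"
  "quad (cycle_sum n) = insert (2 * n + 2, 0) {(i, Suc i) | i. i \<le> 2 * n + 1}"
  by (auto simp: cycle_sum_def path_sum_words simp del: path_sum.simps)

lemma degenerate_cycle_sum: "degenerate (cycle_sum n)"
proof -
  let ?E = "quad (cycle_sum n)"
  have step: "(i, Suc i) \<in> ?E \<union> ?E\<inverse>" if "i \<le> 2 * n + 1" for i
    using that by (simp add: cycle_sum_words)
  have "k \<le> n \<Longrightarrow> odd_walk ?E 0 (2 * k + 1)" for k
  proof (induction k)
    case 0
    show ?case using odd_walk.edge[OF step[of 0]] by simp
  next
    case (Suc k)
    have "odd_walk ?E 0 (2 * k + 1)" using Suc by simp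
    moreover have "(2 * k + 1, Suc (2 * k + 1)) \<in> ?E \<union> ?E\<inverse>" by (rule step) (use Suc in simp)
    moreover have "(Suc (2 * k + 1), Suc (Suc (2 * k + 1))) \<in> ?E \<union> ?E\<inverse>" by (rule step) (use Suc in simp)
    ultimately have "odd_walk ?E 0 (Suc (Suc (2 * k + 1)))" by (rule odd_walk.extend)
    then show ?case by simp
  qed
  from this[of n] have "odd_walk ?E 0 (2 * n + 1)" by simp
  moreover have "(2 * n + 1, 2 * n + 2) \<in> ?E \<union> ?E\<inverse>" "(2 * n + 2, 0) \<in> ?E \<union> ?E\<inverse>"
    by (simp_all add: cycle_sum_words)
  ultimately have "odd_walk ?E 0 0" by (rule odd_walk.extend)
  then show ?thesis unfolding degenerate_def by blast
qed

lemma cycle_semiring_not_satisfies: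
  fixes n :: nat
  defines "C \<equiv> graph_semiring {..2 * n + 2} (cycle_edges n)"
  shows "\<not> satisfies C (cycle_sum n, Times (cycle_sum n) (Times (cycle_sum n) (cycle_sum n)))"
proof
  interpret nil_semiring C Top
    unfolding C_def by (rule nil_semiring_graph[OF sym_cycle_edges irrefl_cycle_edges])
  assume sat: "satisfies C (cycle_sum n, Times (cycle_sum n) (Times (cycle_sum n) (cycle_sum n)))"
  define h where "h i = Vertices {min i (2 * n + 2)}" for i :: nat
  have "h i \<in> carr C" for i by (simp add: h_def C_def graph_semiring_def)
  then have h: "range h \<subseteq> carr C" by (rule image_subsetI)
  have Edge: "Edge \<in> carr C" by (simp add: C_def graph_semiring_def)
  have "eval_trm C h (cycle_sum n) = eval_trm C h (Times (cycle_sum n) (Times (cycle_sum n) (cycle_sum n)))"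
    using sat[unfolded satisfies_def, rule_format, OF h] by (simp only: fst_conv snd_conv)
  also have "\<dots> = Top" using h by (simp add: cube)
  finally have "eval_trm C h (cycle_sum n) = Top" .
  moreover have "le (mul_op C (h i) (h j)) Edge" if "(i, j) \<in> quad (cycle_sum n)" for i j
  proof -
    have "(i, j) \<in> cycle_edges n" using that by (auto simp: cycle_sum_words cycle_edges_def)
    moreover from this have "h i = Vertices {i}" "h j = Vertices {j}"
      by (simp_all add: cycle_edges_def h_def)
    ultimately have "mul_op C (h i) (h j) = Edge" by (simp add: C_def graph_semiring_def)
    then show ?thesis using le_refl[OF Edge] by metis
  qed
  then have "le (eval_trm C h (cycle_sum n)) Edge"
    unfolding eval_le[OF h Edge] using cycle_sum_words(1,2)[of n] by blast
  ultimately show False using zero_le[OF Edge] by (metis graph_elt.distinct(5))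
qed


section \<open>Subvarieties of the variety generated by SR6\<close>

context
  fixes V :: "('u::infinite) algebra set"
  defines "V \<equiv> variety_generated_by SR6"
begin

lemma satisfies_of_SR6:
  assumes "A \<in> V" "satisfies SR6 e"
  shows "satisfies A e"
proof -
  have "satisfies B e" if "isomorphic SR6 B" for B :: "'u algebra"
    using satisfies_isomorphic[OF that] assms(2) by blast
  moreover have "is_algebra B" if "isomorphic SR6 B" for B :: "'u algebra"
    using that unfolding isomorphic_def alg_hom_def by blast
  ultimately have "\<forall>B :: 'u algebra. isomorphic SR6 B \<longrightarrow> B \<in> models {e}" by (simp add: models_def)
  then have "V \<subseteq> models {e}"
    unfolding V_def variety_generated_by_def using variety_models[of "{e}"] by (intro Inter_lower) simp
  then show ?thesis using assms(1) by (auto simp: models_def)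
qed

lemma variety_V: "variety V"
  unfolding V_def by (rule variety_variety_generated_by)

lemma is_algebra_V: "A \<in> V \<Longrightarrow> is_algebra A"
  using variety_V unfolding variety_def by (elim conjE) blast

lemma bipartite_semiring_V:
  assumes "A \<in> V"
  obtains z where "bipartite_semiring A z"
  using bipartite_semiring_of_SR6[OF is_algebra_V[OF assms] satisfies_of_SR6[OF assms]] .

text \<open>
  A subvariety is proper iff it omits the copies of SR6, hence, by Birkhoff's theorem, iff it
  satisfies an identity that fails in SR6.
\<close>

lemma SR6_copy:
  obtains S :: "'u algebra" where "isomorphic SR6 S" "S \<in> V" "\<And>W. variety W \<Longrightarrow> S \<in> W \<Longrightarrow> V \<subseteq> W"
proof -
  have "finite (carr SR6)" by (simp add: SR6_def)
  then obtain S :: "'u algebra" where S: "isomorphic SR6 S"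
    using finite_isomorphic_copy[OF SR6.alg] by blast
  have "S \<in> V" using S unfolding V_def variety_generated_by_def by blast
  moreover have "V \<subseteq> W" if W: "variety W" "S \<in> W" for W
  proof -
    have "B \<in> W" if B: "isomorphic SR6 B" for B
    proof -
      have "homomorphic_image B S"
        using homomorphic_image_trans[OF isomorphic_imp_homomorphic_image[OF B]
            isomorphic_imp_homomorphic_image[OF isomorphic_sym[OF S]]] .
      moreover have "\<forall>A\<in>W. \<forall>B. homomorphic_image B A \<longrightarrow> B \<in> W"
        using W(1) unfolding variety_def by (elim conjE)
      ultimately show ?thesis using W(2) by blast
    qed
    then show ?thesis using W(1) unfolding V_def variety_generated_by_def by (intro Inter_lower) simp
  qed
  ultimately show ?thesis using S that by blast
qed

text \<open>
  A finite basis would mention fewer variables than the vertices of some odd cycle. The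
  semiring of that cycle satisfies all identities of SR6 with so few variables, but it does
  not satisfy the identity saying that the sum of the products along the cycle is zero.
\<close>

lemma not_finitely_based_V: "\<not> finitely_based V"
proof
  assume "finitely_based V"
  then obtain \<Sigma> where fin: "finite \<Sigma>" and V: "V = models \<Sigma>" by (auto simp: finitely_based_def)
  obtain S :: "'u algebra" where S: "isomorphic SR6 S" "S \<in> V" using SR6_copy by metis
  have SR6_sat: "same_normal_form s t" if "(s, t) \<in> \<Sigma>" for s t
  proof -
    have "satisfies S (s, t)" using S(2) that unfolding V models_def by blast
    then show ?thesis using satisfies_isomorphic[OF S(1)] satisfies_SR6 by blast
  qed
  \<comment> \<open>Large enough that the odd cycle has more vertices than the graph of any term in the basis.\<close>
  define n where "n = (\<Sum>(s, t)\<in>\<Sigma>. card (Field (quad s)) + card (Field (quad t)))"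
  have size: "card (Field (quad s)) \<le> 2 * n + 2" "card (Field (quad t)) \<le> 2 * n + 2"
    if "(s, t) \<in> \<Sigma>" for s t
  proof -
    have "card (Field (quad s)) + card (Field (quad t)) \<le> n"
      using member_le_sum[OF that, of "\<lambda>(s, t). card (Field (quad s)) + card (Field (quad t))"] fin
      by (simp add: n_def)
    then show "card (Field (quad s)) \<le> 2 * n + 2" "card (Field (quad t)) \<le> 2 * n + 2" by linarith+
  qed
  define C where "C = graph_semiring {..2 * n + 2} (cycle_edges n)"
  interpret C: nil_semiring C Top
    unfolding C_def by (rule nil_semiring_graph[OF sym_cycle_edges irrefl_cycle_edges])
  have Top: "eval_trm C h t = Top"
    if "range h \<subseteq> carr C" "degenerate t" "card (Field (quad t)) \<le> 2 * n + 2" for h t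
    unfolding C_def
    by (rule graph_semiring_degenerate[OF sym_cycle_edges irrefl_cycle_edges _ that(1)[unfolded C_def] that(2,3)])
      (rule proper_colouring_cycle)
  have C_sat: "satisfies C (s, t)" if st: "(s, t) \<in> \<Sigma>" for s t
  proof -
    have "eval_trm C h s = eval_trm C h t" if h: "range h \<subseteq> carr C" for h
      using SR6_sat[OF st] unfolding same_normal_form_def
    proof (elim disjE conjE)
      assume "degenerate s" "degenerate t"
      then show ?thesis using Top[OF h] size[OF st] by metis
    next
      assume "lin s = lin t" "quad s \<union> (quad s)\<inverse> = quad t \<union> (quad t)\<inverse>"
        and "\<not> degenerate s" "\<not> degenerate t"
      then show ?thesis by (intro C.eval_lin_quad_cong[OF h]) (simp_all add: degenerate_def)
    qed
    then show ?thesis by (simp add: satisfies_def)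
  qed
  have "finite (carr C)" by (simp add: C_def graph_semiring_def)
  then obtain D :: "'u algebra" where D: "isomorphic C D" using finite_isomorphic_copy[OF C.alg] by blast
  have "D \<in> models \<Sigma>"
  proof -
    have "is_algebra D" using D by (auto simp: isomorphic_def alg_hom_def)
    moreover have "satisfies D e" if "e \<in> \<Sigma>" for e
      using C_sat[of "fst e" "snd e"] that satisfies_isomorphic[OF D] by simp
    ultimately show ?thesis by (simp add: models_def)
  qed
  then have "D \<in> V" by (simp add: V)
  from satisfies_of_SR6[OF this degenerate_cube[OF degenerate_cycle_sum[of n]]]
  have "satisfies C (cycle_sum n, Times (cycle_sum n) (Times (cycle_sum n) (cycle_sum n)))"
    using satisfies_isomorphic[OF D] by blast
  then show False using cycle_semiring_not_satisfies[of n] by (simp add: C_def)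
qed

text \<open>
  An identity failing in SR6 forces the path law. A member of \<open>W\<close> with nonzero products then
  shows that \<open>W\<close> satisfies no identities other than those valid in all nil semirings with the
  path law, and by Birkhoff's theorem \<open>W\<close> contains all algebras with that law. If all products
  in \<open>W\<close> are zero, the same argument applies with a member having more than one element;
  otherwise \<open>W\<close> is trivial.
\<close>

lemma proper_subvariety_finitely_based:
  assumes W: "variety W" "W \<subset> V"
  shows "finitely_based W"
proof -
  have WV: "A \<in> V" if "A \<in> W" for A using W(2) that by blast
  have W_alg: "is_algebra A" if "A \<in> W" for A using is_algebra_V[OF WV[OF that]] .
  have W_nil: "A \<in> models nil_basis" if A: "A \<in> W" for A
  proof -
    obtain z where "bipartite_semiring A z" using bipartite_semiring_V[OF WV[OF A]] .
    then interpret bipartite_semiring A z .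
    show ?thesis by (rule models_nil_basis)
  qed
  obtain S :: "'u algebra" where S: "isomorphic SR6 S" "\<And>W. variety W \<Longrightarrow> S \<in> W \<Longrightarrow> V \<subseteq> W"
    using SR6_copy by metis
  have "S \<notin> W" using S(2)[OF W(1)] W(2) by blast
  have "is_algebra S" using S(1) by (auto simp: isomorphic_def alg_hom_def)
  obtain e where e: "\<And>A. A \<in> W \<Longrightarrow> satisfies A e" "\<not> satisfies SR6 e"
    using variety_closed_under_identities[OF W(1) \<open>is_algebra S\<close>] \<open>S \<notin> W\<close> satisfies_isomorphic[OF S(1)]
    by blast
  obtain s t where st: "e = (s, t)" by (cases e)
  have path: "satisfies A path_identity" if A: "A \<in> W" for A
  proof -
    obtain z where "bipartite_semiring A z" using bipartite_semiring_V[OF WV[OF A]] .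
    then interpret bipartite_semiring A z .
    have "\<not> same_normal_form s t" using e(2) satisfies_SR6 unfolding st by blast
    then have path_law using path_law_or_same_normal_form e(1)[OF A] unfolding st by blast
    then show ?thesis by (simp add: satisfies_path_identity)
  qed
  have finite_nil: "finite nil_basis" by (simp add: nil_basis_def)
  consider A where "A \<in> W" "\<not> satisfies A null_identity"
    | A where "\<And>A. A \<in> W \<Longrightarrow> satisfies A null_identity" "A \<in> W" "\<not> satisfies A trivial_identity"
    | "\<And>A. A \<in> W \<Longrightarrow> satisfies A trivial_identity"
    by blast
  then show ?thesis
  proof cases
    case (1 A)
    obtain z where "bipartite_semiring A z" using bipartite_semiring_V[OF WV[OF 1(1)]] .
    then interpret A: bipartite_semiring A z .
    have "W = models (insert path_identity nil_basis)"
    proof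
      show "W \<subseteq> models (insert path_identity nil_basis)"
        using W_nil path by (auto simp: models_def)
      show "models (insert path_identity nil_basis) \<subseteq> W"
      proof
        fix B :: "'u algebra" assume B: "B \<in> models (insert path_identity nil_basis)"
        then have "B \<in> models nil_basis" by (simp add: models_def)
        then obtain y where "nil_semiring B y" by (rule nil_semiring_of_basis)
        then interpret B: nil_semiring B y .
        have B_path: B.path_law using B by (simp add: models_def B.satisfies_path_identity)
        show "B \<in> W"
        proof (rule variety_closed_under_identities[OF W(1) B.alg])
          fix e assume sat: "\<And>B. B \<in> W \<Longrightarrow> satisfies B e"
          obtain s t where st: "e = (s, t)" by (cases e)
          have "same_components s t"
            using A.null_or_same_components[of s t] sat[OF 1(1)] 1(2) A.satisfies_null_identity
            unfolding st by blast
          then show "satisfies B e" unfolding st by (rule B.satisfies_same_components[OF B_path])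
        qed
      qed
    qed
    then show ?thesis using finite_nil unfolding finitely_based_def by blast
  next
    case (2 A)
    obtain z where "bipartite_semiring A z" using bipartite_semiring_V[OF WV[OF 2(2)]] .
    then interpret A: bipartite_semiring A z .
    have A_nontrivial: "carr A \<noteq> {z}"
    proof
      assume "carr A = {z}"
      then have "h 0 = h 1" if "range h \<subseteq> carr A" for h :: "nat \<Rightarrow> 'u"
        using that by (metis rangeI singletonD subsetD)
      then have "satisfies A trivial_identity" by (simp add: satisfies_def trivial_identity_def)
      then show False using 2(3) by blast
    qed
    have "W = models (insert null_identity nil_basis)"
    proof
      show "W \<subseteq> models (insert null_identity nil_basis)"
        using W_nil 2(1) by (auto simp: models_def)
      show "models (insert null_identity nil_basis) \<subseteq> W"
      proof
        fix B :: "'u algebra" assume B: "B \<in> models (insert null_identity nil_basis)"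
        then have "B \<in> models nil_basis" by (simp add: models_def)
        then obtain y where "nil_semiring B y" by (rule nil_semiring_of_basis)
        then interpret B: nil_semiring B y .
        have B_null: B.null using B by (simp add: models_def B.satisfies_null_identity)
        show "B \<in> W"
        proof (rule variety_closed_under_identities[OF W(1) B.alg])
          fix e assume sat: "\<And>B. B \<in> W \<Longrightarrow> satisfies B e"
          obtain s t where st: "e = (s, t)" by (cases e)
          have "same_linear_part s t"
            using A.trivial_or_same_linear_part[of s t] sat[OF 2(2)] A_nontrivial unfolding st by blast
          then show "satisfies B e" unfolding st by (rule B.satisfies_same_linear_part[OF B_null])
        qed
      qed
    qed
    then show ?thesis using finite_nil unfolding finitely_based_def by blast
  next
    case 3
    have "W = models {trivial_identity}"
    proof
      show "W \<subseteq> models {trivial_identity}" using 3 W_alg by (auto simp: models_def)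
      show "models {trivial_identity} \<subseteq> W"
      proof
        fix B :: "'u algebra" assume B: "B \<in> models {trivial_identity}"
        then have alg: "is_algebra B" by (simp add: models_def)
        have eq: "a = b" if "a \<in> carr B" "b \<in> carr B" for a b
          using B satisfies_assign[of B "Var 0" "Var 1" a b b b] that
          by (simp add: models_def trivial_identity_def)
        have "satisfies B e" for e
          using eq eval_closed[OF alg] by (simp add: satisfies_def)
        then show "B \<in> W" by (intro variety_closed_under_identities[OF W(1) alg])
      qed
    qed
    then show ?thesis unfolding finitely_based_def by blast
  qed
qed

end

theorem theorem5p4:
  shows "limit_variety (variety_generated_by SR6 :: ('u::infinite) algebra set)"
  unfolding limit_variety_def
  using variety_variety_generated_by not_finitely_based_V proper_subvariety_finitely_based by blast

end
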